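(* Let $f:\mathbb{R}^n\to\mathbb{R}^n$ be a $C^1$ vector field such that the flow $\phi_t$ of $\dot x=f(x)$ is defined for all $t\ge 0$ on $\mathbb{R}^n$. Suppose the system is nonexpansive on $\mathbb{R}^n$ with respect to a strictly convex norm $\|\cdot\|$ on $\mathbb{R}^n$, and that it has at least one bounded trajectory $\{\phi_t(x): t\ge 0\}$. Then every trajectory $\{\phi_t(x_0):t\ge0\}$, $x_0\in\mathbb{R}^n$, is bounded, and the omega limit sets are, up to a fixed translation, omega limit sets of one fixed conserved linear system: there exist a conserved linear system $\dot z=Bz$ on $\mathbb{R}^n$ ($B\in\mathbb{R}^{n\times n}$) and a point $x^*\in\mathbb{R}^n$ such that for every $x_0\in\mathbb{R}^n$ there is $z_0\in\mathbb{R}^n$ with $\omega(x_0)=x^*+\omega_B(z_0)$, where $\omega_B(z_0)$ is the omega limit set of $z_0$ under $\dot z=Bz$. In particular, for every $x_0\in\mathbb{R}^n$ the omega limit set $\omega(x_0)$ is homeomorphic to $(S^1)^k$ for some integer $k\ge 0$ (possibly depending on $x_0$).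
   Context: The system $\dot x=f(x)$ is nonexpansive with respect to $\|\cdot\|$ on a forward invariant set $X$ if $\|\phi_t(x)-\phi_t(y)\|\le\|x-y\|$ for all $x,y\in X$ and $t>0$; here $X=\mathbb{R}^n$. A norm is strictly convex if whenever $x\ne y$ and $\|x\|=\|y\|=r>0$, then $\|\alpha x+(1-\alpha)y\|<r$ for all $0<\alpha<1$. The omega limit set of $x$ is $\omega(x)=\bigcap_{t\ge0}\overline{\bigcup_{s\ge t}\{\phi_s(x)\}}$. A linear system $\dot z=Bz$ with $B$ a real square matrix is called conserved if all its trajectories $\{e^{Bt}z_0:t\ge0\}$ are bounded and no trajectory with $z_0\neq0$ converges to $0$ as $t\to\infty$. $S^1$ is the circle, $(S^1)^k$ is the $k$-torus, and $(S^1)^0$ is a single point. *)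

theory Defs
  imports "HOL-Analysis.Analysis"
begin

definition C1_field :: "(real ^ 'n \<Rightarrow> real ^ 'n) \<Rightarrow> bool" where
  "C1_field f \<longleftrightarrow>
     (\<exists>f' :: real ^ 'n \<Rightarrow> (real ^ 'n) \<Rightarrow>\<^sub>L (real ^ 'n).
        (\<forall>x. (f has_derivative blinfun_apply (f' x)) (at x)) \<and> continuous_on UNIV f')"

text \<open>
  The time argument of a flow comes first. Only times \<open>t \<ge> 0\<close> are constrained; at \<open>t = 0\<close> the
  derivative is one-sided. For a \<open>C\<^sup>1\<close> field the solutions are unique, so \<open>\<phi>\<close> is determined on
  \<open>t \<ge> 0\<close>.
\<close>

definition forward_flow ::
  "(real ^ 'n \<Rightarrow> real ^ 'n) \<Rightarrow> (real \<Rightarrow> real ^ 'n \<Rightarrow> real ^ 'n) \<Rightarrow> bool" where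
  "forward_flow f \<phi> \<longleftrightarrow>
     (\<forall>x. \<phi> 0 x = x \<and>
          (\<forall>t\<ge>0. ((\<lambda>s. \<phi> s x) has_vector_derivative f (\<phi> t x)) (at t within {0..})))"

definition trajectory :: "(real \<Rightarrow> 'a \<Rightarrow> 'a) \<Rightarrow> 'a \<Rightarrow> 'a set" where
  "trajectory \<phi> x = {\<phi> t x | t. t \<ge> 0}"

definition omega_limit :: "(real \<Rightarrow> 'a \<Rightarrow> 'a) \<Rightarrow> 'a \<Rightarrow> 'a::topological_space set" where
  "omega_limit \<phi> x = (\<Inter>t\<in>{0..}. closure (\<Union>s\<in>{t..}. {\<phi> s x}))"

text \<open>
  An arbitrary norm is a function on the space, since the type class fixes \<open>norm\<close> on
  \<open>real ^ 'n\<close> to be the Euclidean one.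
\<close>

definition is_norm :: "('a::real_vector \<Rightarrow> real) \<Rightarrow> bool" where
  "is_norm N \<longleftrightarrow>
     (\<forall>x. 0 \<le> N x) \<and> (\<forall>x. N x = 0 \<longleftrightarrow> x = 0) \<and>
     (\<forall>a x. N (a *\<^sub>R x) = \<bar>a\<bar> * N x) \<and> (\<forall>x y. N (x + y) \<le> N x + N y)"

definition strictly_convex_norm :: "('a::real_vector \<Rightarrow> real) \<Rightarrow> bool" where
  "strictly_convex_norm N \<longleftrightarrow> is_norm N \<and>
     (\<forall>x y r. x \<noteq> y \<and> N x = r \<and> N y = r \<and> r > 0 \<longrightarrow>
        (\<forall>\<alpha>. 0 < \<alpha> \<and> \<alpha> < 1 \<longrightarrow> N (\<alpha> *\<^sub>R x + (1 - \<alpha>) *\<^sub>R y) < r))"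

definition nonexpansive_on ::
  "('a::real_vector \<Rightarrow> real) \<Rightarrow> 'a set \<Rightarrow> (real \<Rightarrow> 'a \<Rightarrow> 'a) \<Rightarrow> bool" where
  "nonexpansive_on N X \<phi> \<longleftrightarrow>
     (\<forall>x\<in>X. \<forall>y\<in>X. \<forall>t>0. N (\<phi> t x - \<phi> t y) \<le> N (x - y))"

definition matrix_power :: "real ^ 'n ^ 'n \<Rightarrow> nat \<Rightarrow> real ^ 'n ^ 'n" where
  "matrix_power A k = ((\<lambda>M. A ** M) ^^ k) (mat 1)"

text \<open>
  The library's \<open>exp\<close> does not apply to \<open>real ^ 'n ^ 'n\<close>, whose class multiplication
  is componentwise.
\<close>

definition matrix_exp :: "real ^ 'n ^ 'n \<Rightarrow> real ^ 'n ^ 'n" where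
  "matrix_exp A = (\<Sum>k. (1 / fact k) *\<^sub>R matrix_power A k)"

definition linear_flow :: "real ^ 'n ^ 'n \<Rightarrow> real \<Rightarrow> real ^ 'n \<Rightarrow> real ^ 'n" where
  "linear_flow B t z = matrix_exp (t *\<^sub>R B) *v z"

definition conserved :: "real ^ 'n ^ 'n \<Rightarrow> bool" where
  "conserved B \<longleftrightarrow>
     (\<forall>z. bounded (trajectory (linear_flow B) z)) \<and>
     (\<forall>z. z \<noteq> 0 \<longrightarrow> \<not> ((\<lambda>t. linear_flow B t z) \<longlongrightarrow> 0) at_top)"

text \<open>
  Elements of the product are functions that are \<open>undefined\<close> outside \<open>{..<k}\<close>, so the
  case \<open>k = 0\<close> is a one-point space.
\<close>

definition torus :: "nat \<Rightarrow> (nat \<Rightarrow> complex) topology" where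
  "torus k = product_topology (\<lambda>_. top_of_set (sphere 0 1)) {..<k}"

end

theory Submission
  imports Defs
    "HOL-Computational_Algebra.Fundamental_Theorem_Algebra"
    "HOL-Complex_Analysis.Great_Picard"
begin

text \<open>
  Why the theorem holds. Write \<open>\<phi>\<close> for the flow. One bounded orbit and nonexpansiveness make all
  orbits bounded, so every sequence of nonnegative times has a subsequence along which the maps \<open>\<phi> t\<close> converge
  at every point. Passing to differences of such times gives times \<open>\<sigma> k \<rightarrow> \<infinity>\<close> for which
  \<open>\<phi> (\<sigma> k)\<close> converges to a map \<open>e\<close> with \<open>e \<circ> e = e\<close>, and every orbit is asymptotic to the orbit
  of \<open>e x\<close> (\<open>limit_retraction_exists\<close>). Hence omega limit sets only depend on the flow on the set \<open>E\<close> of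
  fixed points of \<open>e\<close>, the recurrent points.
  
  On \<open>E\<close> nothing is lost: the distance of two points is recovered along \<open>\<sigma>\<close>, so \<open>\<phi> t\<close> is an
  isometry there (\<open>flow_isometry\<close>). In a strictly convex norm a point of a segment is determined by its distances
  from the two ends (\<open>strictly_convex_norm_between\<close>). Therefore \<open>E\<close> is convex and \<open>\<phi> t\<close> is affine on \<open>E\<close>
  (\<open>retract_convex\<close>, \<open>flow_affine\<close>). There is an equilibrium \<open>x\<^sup>*\<close>, the centre of the smallest ball
  around a recurrent orbit, which is unique by strict convexity (\<open>fixed_point_exists\<close>). So \<open>f\<close> agrees on \<open>E\<close> with its
  linearization at \<open>x\<^sup>*\<close>; restricted to the span of \<open>E - x\<^sup>*\<close> and extended by zero on the orthogonal complement,
  this linearization is the matrix \<open>B\<close>. It is conserved since its flow preserves the norm on the span and is constant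
  on the complement (\<open>conserved_linear_conjugate\<close>).
  
  It remains to show that the omega limit set of any point \<open>z\<close> of a conserved linear system is a torus
  (\<open>conserved_omega_limit_torus\<close>). An annihilating polynomial
  splits \<open>z\<close> into complex eigenvectors \<open>c\<^sub>l\<close>; boundedness and the absence of decay force the eigenvalues to be
  imaginary and exclude Jordan blocks. Thus the orbit is \<open>\<Sum> exp (l t) c\<^sub>l\<close>. Choose an integral basis
  \<open>\<theta>\<^sub>1, \<dots>, \<theta>\<^sub>k\<close> of the group generated by the frequencies (\<open>Z_basis_exists\<close>). The orbit is then the image of the
  line with slope \<open>\<theta>\<close> in the \<open>k\<close>-torus under a continuous map whose coefficients at the \<open>c\<^sub>l\<close> are monomials in the coordinates.
  By Kronecker's theorem the line is dense, so the image of the torus is the omega limit set; the map is injective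
  because the \<open>\<theta>\<^sub>i\<close> are in turn integral combinations of the frequencies.
\<close>

section \<open>The matrix exponential and linear differential equations\<close>

lemma matrix_power_0: "matrix_power A 0 = mat 1"
  by (simp add: matrix_power_def)

lemma matrix_power_Suc: "matrix_power A (Suc k) = A ** matrix_power A k"
  by (simp add: matrix_power_def)

lemma matrix_power_Suc_right: "matrix_power A (Suc k) = matrix_power A k ** A"
  by (induction k) (simp_all add: matrix_power_0 matrix_power_Suc matrix_mul_assoc)

lemma matrix_power_scaleR: "matrix_power (t *\<^sub>R A) k = t ^ k *\<^sub>R matrix_power A k"
  by (induction k)
    (simp_all add: matrix_power_0 matrix_power_Suc matrix_matrix_mult_def vec_eq_iff sum_distrib_left mult_ac)

text \<open>
  The constant dominates every row sum of \<open>\<bar>A\<bar>\<close>, so one more factor \<open>A\<close> costs at most one more factor of it.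
\<close>

lemma matrix_power_entry_bound:
  fixes A :: "real ^ 'n ^ 'n"
  shows "\<bar>matrix_power A k $ i $ j\<bar> \<le> (\<Sum>i\<in>UNIV. \<Sum>j\<in>UNIV. \<bar>A $ i $ j\<bar>) ^ k"
proof (induction k arbitrary: i)
  case 0
  then show ?case by (simp add: matrix_power_0 mat_def)
next
  case (Suc k)
  let ?M = "\<Sum>i\<in>UNIV. \<Sum>j\<in>UNIV. \<bar>A $ i $ j\<bar>"
  have "\<bar>matrix_power A (Suc k) $ i $ j\<bar> \<le> (\<Sum>l\<in>UNIV. \<bar>A $ i $ l * matrix_power A k $ l $ j\<bar>)"
    by (simp add: matrix_power_Suc matrix_matrix_mult_def)
  also have "\<dots> \<le> (\<Sum>l\<in>UNIV. \<bar>A $ i $ l\<bar> * ?M ^ k)"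
    by (intro sum_mono) (simp add: abs_mult Suc mult_left_mono)
  also have "\<dots> = (\<Sum>l\<in>UNIV. \<bar>A $ i $ l\<bar>) * ?M ^ k"
    by (simp add: sum_distrib_right)
  also have "\<dots> \<le> ?M * ?M ^ k"
    by (intro mult_right_mono zero_le_power sum_nonneg
        member_le_sum[where f = "\<lambda>i. \<Sum>j\<in>UNIV. \<bar>A $ i $ j\<bar>"]) (auto intro: sum_nonneg)
  finally show ?case by simp
qed

lemma matrix_exp_entry_summable:
  fixes A :: "real ^ 'n ^ 'n"
  shows "summable (\<lambda>k. matrix_power A k $ i $ j / fact k * t ^ k)"
proof (rule summable_comparison_test)
  let ?M = "\<Sum>i\<in>UNIV. \<Sum>j\<in>UNIV. \<bar>A $ i $ j\<bar>"
  show "summable (\<lambda>k. (?M * \<bar>t\<bar>) ^ k /\<^sub>R fact k)"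
    by (rule summable_exp_generic)
  have "norm (matrix_power A k $ i $ j / fact k * t ^ k) \<le> (?M * \<bar>t\<bar>) ^ k /\<^sub>R fact k" for k
    using mult_right_mono[OF matrix_power_entry_bound[of A k i j], of "\<bar>t\<bar> ^ k / fact k"]
    by (simp add: abs_mult power_abs power_mult_distrib field_simps)
  then show "\<exists>N. \<forall>k\<ge>N. norm (matrix_power A k $ i $ j / fact k * t ^ k) \<le> (?M * \<bar>t\<bar>) ^ k /\<^sub>R fact k"
    by blast
qed

lemma matrix_exp_entry:
  fixes A :: "real ^ 'n ^ 'n"
  shows "matrix_exp (t *\<^sub>R A) $ i $ j = (\<Sum>k. matrix_power A k $ i $ j / fact k * t ^ k)"
proof -
  have "(\<lambda>k. (1 / fact k) *\<^sub>R matrix_power (t *\<^sub>R A) k) sums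
          (\<chi> i j. \<Sum>k. matrix_power A k $ i $ j / fact k * t ^ k)"
    unfolding sums_def
  proof (intro vec_tendstoI)
    fix i j
    show "(\<lambda>n. (\<Sum>k<n. (1 / fact k) *\<^sub>R matrix_power (t *\<^sub>R A) k) $ i $ j) \<longlonglongrightarrow>
            (\<chi> i j. \<Sum>k. matrix_power A k $ i $ j / fact k * t ^ k) $ i $ j"
      using matrix_exp_entry_summable[of A i j t, THEN summable_sums]
      by (simp add: sums_def matrix_power_scaleR mult_ac)
  qed
  then show ?thesis
    by (simp add: matrix_exp_def sums_iff)
qed

text \<open>
  Each entry is a power series in \<open>t\<close> that converges everywhere, hence may be differentiated termwise.
\<close>

lemma matrix_exp_entry_deriv:
  fixes A :: "real ^ 'n ^ 'n"
  shows "((\<lambda>t. matrix_exp (t *\<^sub>R A) $ i $ j) has_real_derivative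
           (matrix_exp (t *\<^sub>R A) ** A) $ i $ j) (at t)"
proof -
  let ?c = "\<lambda>i j k. matrix_power A k $ i $ j / fact k"
  have "((\<lambda>t. \<Sum>k. ?c i j k * t ^ k) has_real_derivative (\<Sum>k. diffs (?c i j) k * t ^ k)) (at t)"
    by (intro termdiffs_strong_converges_everywhere matrix_exp_entry_summable)
  moreover have "(\<Sum>k. diffs (?c i j) k * t ^ k) = (matrix_exp (t *\<^sub>R A) ** A) $ i $ j"
  proof -
    have "diffs (?c i j) k * t ^ k = (\<Sum>l\<in>UNIV. ?c i l k * t ^ k * A $ l $ j)" for k
      by (simp add: diffs_def matrix_power_Suc_right matrix_matrix_mult_def field_simps
          sum_distrib_left sum_divide_distrib del: of_nat_Suc)
    then have "(\<Sum>k. diffs (?c i j) k * t ^ k) = (\<Sum>k. \<Sum>l\<in>UNIV. ?c i l k * t ^ k * A $ l $ j)"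
      by presburger
    also have "\<dots> = (\<Sum>l\<in>UNIV. \<Sum>k. ?c i l k * t ^ k * A $ l $ j)"
      by (intro suminf_sum summable_mult2 matrix_exp_entry_summable)
    also have "\<dots> = (\<Sum>l\<in>UNIV. matrix_exp (t *\<^sub>R A) $ i $ l * A $ l $ j)"
      unfolding matrix_exp_entry
      by (intro sum.cong refl suminf_mult2[symmetric] matrix_exp_entry_summable)
    also have "\<dots> = (matrix_exp (t *\<^sub>R A) ** A) $ i $ j"
      by (simp add: matrix_matrix_mult_def)
    finally show ?thesis .
  qed
  ultimately show ?thesis
    by (simp add: matrix_exp_entry)
qed

lemma matrix_exp_0: "matrix_exp 0 = (mat 1 :: real ^ 'n ^ 'n)"
proof -
  have "matrix_exp (0 *\<^sub>R (0 :: real ^ 'n ^ 'n)) $ i $ j = mat 1 $ i $ j" for i j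
    unfolding matrix_exp_entry by (subst powser_zero) (simp add: matrix_power_0)
  then show ?thesis
    by (simp add: vec_eq_iff)
qed

text \<open>
  For a solution \<open>u\<close>, the quantity \<open>exp ((t - s) A) u(s)\<close> does not depend on \<open>s\<close>.
\<close>

lemma linear_flow_unique:
  fixes A :: "real ^ 'n ^ 'n" and u :: "real \<Rightarrow> real ^ 'n"
  assumes deriv: "\<And>s i. 0 \<le> s \<Longrightarrow>
      ((\<lambda>s. u s $ i) has_real_derivative (A *v u s) $ i) (at s within {0..})"
    and "0 \<le> t"
  shows "u t = linear_flow A t (u 0)"
proof -
  let ?E = "\<lambda>s. matrix_exp (s *\<^sub>R A)"
  let ?h = "\<lambda>s. ?E (t - s) *v u s"
  have "?h 0 $ i = ?h t $ i" for i
  proof (rule has_field_derivative_zero_constant[of "{0..t}" "\<lambda>s. ?h s $ i", THEN exE])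
    fix s assume s: "s \<in> {0..t}"
    have E: "((\<lambda>s. ?E (t - s) $ i $ j) has_real_derivative - (?E (t - s) ** A) $ i $ j) (at s within {0..t})"
      for j
    proof -
      have "((\<lambda>s. ?E (t - s) $ i $ j) has_real_derivative (?E (t - s) ** A) $ i $ j * (0 - 1)) (at s)"
        by (rule DERIV_chain2[OF matrix_exp_entry_deriv]) (intro derivative_intros)
      then show ?thesis
        by (simp add: has_field_derivative_at_within)
    qed
    have u: "((\<lambda>s. u s $ j) has_real_derivative (A *v u s) $ j) (at s within {0..t})" for j
      using deriv[of s j] s by (auto intro: has_field_derivative_subset)
    have "((\<lambda>s. \<Sum>j\<in>UNIV. ?E (t - s) $ i $ j * u s $ j) has_real_derivative
            (\<Sum>j\<in>UNIV. ?E (t - s) $ i $ j * (A *v u s) $ j + - (?E (t - s) ** A) $ i $ j * u s $ j)) (at s within {0..t})"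
      by (intro DERIV_sum DERIV_mult' E u)
    moreover have "(\<Sum>j\<in>UNIV. ?E (t - s) $ i $ j * (A *v u s) $ j + - (?E (t - s) ** A) $ i $ j * u s $ j)
        = (?E (t - s) *v (A *v u s)) $ i - ((?E (t - s) ** A) *v u s) $ i"
      by (simp add: matrix_vector_mult_def[of "?E (t - s)"] matrix_vector_mult_def[of "?E (t - s) ** A"]
          sum_subtractf)
    ultimately show "((\<lambda>s. ?h s $ i) has_real_derivative 0) (at s within {0..t})"
      by (simp add: matrix_vector_mul_assoc matrix_vector_mult_def[of "?E (t - _)"])
  next
    fix c assume "\<forall>s\<in>{0..t}. ?h s $ i = c"
    then have "?h 0 $ i = c" "?h t $ i = c"
      using \<open>0 \<le> t\<close> by (blast intro: atLeastAtMost_iff[THEN iffD2])+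
    then show "?h 0 $ i = ?h t $ i"
      by (rule trans[OF _ sym])
  qed (simp add: convex_real_interval)
  then have "?h 0 = ?h t"
    by (simp add: vec_eq_iff)
  then show ?thesis
    by (simp add: linear_flow_def matrix_exp_0)
qed

lemma linear_flow_add: "linear_flow A t (x + y) = linear_flow A t x + linear_flow A t y"
  by (simp add: linear_flow_def matrix_vector_right_distrib)

lemma linear_flow_scaleR: "linear_flow A t (c *\<^sub>R x) = c *\<^sub>R linear_flow A t x"
  by (simp add: linear_flow_def matrix_vector_mult_scaleR)

section \<open>Complex eigenvectors of conserved systems\<close>

definition complexify :: "real ^ 'n \<Rightarrow> complex ^ 'n" where
  "complexify x = (\<chi> i. of_real (x $ i))"

definition Re_vec :: "complex ^ 'n \<Rightarrow> real ^ 'n" where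
  "Re_vec v = (\<chi> i. Re (v $ i))"

definition Im_vec :: "complex ^ 'n \<Rightarrow> real ^ 'n" where
  "Im_vec v = (\<chi> i. Im (v $ i))"

definition complexify_matrix :: "real ^ 'n ^ 'n \<Rightarrow> complex ^ 'n ^ 'n" where
  "complexify_matrix A = (\<chi> i j. of_real (A $ i $ j))"

lemma Re_vec_complexify [simp]: "Re_vec (complexify x) = x"
  and Im_vec_complexify [simp]: "Im_vec (complexify x) = 0"
  by (simp_all add: complexify_def Re_vec_def Im_vec_def vec_eq_iff)

lemma complexify_Re_vec: "Im_vec v = 0 \<Longrightarrow> complexify (Re_vec v) = v"
  by (simp add: complexify_def Re_vec_def Im_vec_def vec_eq_iff complex_eq_iff)

lemma Re_Im_vec_eq_0: "Re_vec v = 0 \<Longrightarrow> Im_vec v = 0 \<Longrightarrow> v = 0"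
  by (simp add: Re_vec_def Im_vec_def vec_eq_iff complex_eq_iff)

lemma bounded_linear_Re_vec: "bounded_linear Re_vec"
  and bounded_linear_Im_vec: "bounded_linear Im_vec"
proof -
  show "bounded_linear Re_vec"
    by (auto intro!: linear_conv_bounded_linear[THEN iffD1] linearI simp: Re_vec_def vec_eq_iff)
  show "bounded_linear Im_vec"
    by (auto intro!: linear_conv_bounded_linear[THEN iffD1] linearI simp: Im_vec_def vec_eq_iff)
qed

lemma Re_vec_sum: "Re_vec (\<Sum>i\<in>I. v i) = (\<Sum>i\<in>I. Re_vec (v i))"
  and Im_vec_sum: "Im_vec (\<Sum>i\<in>I. v i) = (\<Sum>i\<in>I. Im_vec (v i))"
  by (simp_all add: Re_vec_def Im_vec_def vec_eq_iff)

lemma norm_vector_scalar_mult: "norm (a *s v) = norm a * norm (v :: complex ^ 'n)"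
  by (simp add: norm_vec_def L2_set_right_distrib norm_mult)

text \<open>
  Bounds on the real and the imaginary part, which the real flow moves separately, bound the complex vector.
\<close>

lemma norm_le_Re_Im_vec: "norm v \<le> norm (Re_vec v) + norm (Im_vec v)"
proof -
  have norm_complexify: "norm (complexify x) = norm x" for x :: "real ^ 'a"
    by (simp add: complexify_def norm_vec_def)
  have "v = complexify (Re_vec v) + \<i> *s complexify (Im_vec v)"
    by (simp add: complexify_def Re_vec_def Im_vec_def vec_eq_iff complex_eq_iff)
  then show ?thesis
    using norm_triangle_ineq[of "complexify (Re_vec v)" "\<i> *s complexify (Im_vec v)"]
    by (simp add: norm_vector_scalar_mult norm_complexify)
qed

text \<open>
  Since \<open>B\<close> is real, the real and the imaginary part of a solution of the complexified equation both solve the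
  real one. This is how complex eigenvectors give information on the real flow.
\<close>

lemma linear_flow_Re_Im_vec:
  fixes B :: "real ^ 'n ^ 'n" and g :: "real \<Rightarrow> complex ^ 'n"
  assumes "\<And>s i. ((\<lambda>s. g s $ i) has_vector_derivative (complexify_matrix B *v g s) $ i) (at s)"
    and "0 \<le> t"
  shows "linear_flow B t (Re_vec (g 0)) = Re_vec (g t)"
    and "linear_flow B t (Im_vec (g 0)) = Im_vec (g t)"
proof -
  have "((\<lambda>s. Re_vec (g s) $ i) has_real_derivative (B *v Re_vec (g s)) $ i) (at s within {0..})" for s i
  proof -
    have "Re ((complexify_matrix B *v g s) $ i) = (B *v Re_vec (g s)) $ i"
      by (simp add: Re_vec_def complexify_matrix_def matrix_vector_mult_def)
    then show ?thesis
      using bounded_linear.has_vector_derivative[OF bounded_linear_Re assms(1)[where s = s and i = i]]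
      unfolding has_real_derivative_iff_has_vector_derivative Re_vec_def
      by (simp add: has_vector_derivative_at_within)
  qed
  from linear_flow_unique[OF this \<open>0 \<le> t\<close>] show "linear_flow B t (Re_vec (g 0)) = Re_vec (g t)"
    by simp
  have "((\<lambda>s. Im_vec (g s) $ i) has_real_derivative (B *v Im_vec (g s)) $ i) (at s within {0..})" for s i
  proof -
    have "Im ((complexify_matrix B *v g s) $ i) = (B *v Im_vec (g s)) $ i"
      by (simp add: Im_vec_def complexify_matrix_def matrix_vector_mult_def)
    then show ?thesis
      using bounded_linear.has_vector_derivative[OF bounded_linear_Im assms(1)[where s = s and i = i]]
      unfolding has_real_derivative_iff_has_vector_derivative Im_vec_def
      by (simp add: has_vector_derivative_at_within)
  qed
  from linear_flow_unique[OF this \<open>0 \<le> t\<close>] show "linear_flow B t (Im_vec (g 0)) = Im_vec (g t)"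
    by simp
qed

text \<open>
  With \<open>y = 0\<close> this is the motion of an eigenvector; with \<open>y \<noteq> 0\<close> it shows the linear growth along a
  Jordan block.
\<close>

lemma linear_flow_Jordan_chain:
  fixes B :: "real ^ 'n ^ 'n" and y z :: "complex ^ 'n"
  assumes y: "complexify_matrix B *v y = l *s y" and z: "complexify_matrix B *v z = l *s z + y"
    and "0 \<le> t"
  shows "linear_flow B t (Re_vec z) = Re_vec (exp (l * of_real t) *s (z + of_real t *s y))"
    and "linear_flow B t (Im_vec z) = Im_vec (exp (l * of_real t) *s (z + of_real t *s y))"
proof -
  let ?g = "\<lambda>t. exp (l * of_real t) *s (z + of_real t *s y)"
  have "((\<lambda>s. ?g s $ i) has_vector_derivative (complexify_matrix B *v ?g s) $ i) (at s)" for s i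
  proof -
    have "((\<lambda>s. exp (l * s) * (z $ i + s * y $ i)) has_field_derivative
        exp (l * s) * (l * z $ i + s * (l * y $ i) + y $ i)) (at s)" for s
      by (auto intro!: derivative_eq_intros simp: algebra_simps)
    from has_vector_derivative_real_field[OF this, of s]
    have "((\<lambda>s. exp (l * of_real s) * (z $ i + of_real s * y $ i)) has_vector_derivative
        exp (l * of_real s) * (l * z $ i + of_real s * (l * y $ i) + y $ i)) (at s)"
      by simp
    then show ?thesis
      by (simp add: vector_scalar_commute matrix_vector_right_distrib y z vec.scale_right_distrib)
        (simp add: algebra_simps)
  qed
  from linear_flow_Re_Im_vec[OF this \<open>0 \<le> t\<close>]
  show "linear_flow B t (Re_vec z) = Re_vec (?g t)" "linear_flow B t (Im_vec z) = Im_vec (?g t)"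
    by simp_all
qed

lemma conserved_Jordan_chain_bounded:
  fixes B :: "real ^ 'n ^ 'n" and y z :: "complex ^ 'n"
  assumes "conserved B"
    and "complexify_matrix B *v y = l *s y" "complexify_matrix B *v z = l *s z + y"
  obtains M where "\<And>t. 0 \<le> t \<Longrightarrow> exp (Re l * t) * norm (z + of_real t *s y) \<le> M"
proof -
  have bd: "\<exists>M. \<forall>t\<ge>0. norm (linear_flow B t x) \<le> M" for x
    using assms(1) unfolding conserved_def trajectory_def bounded_iff by blast
  obtain M1 M2 where M: "\<And>t. t \<ge> 0 \<Longrightarrow> norm (linear_flow B t (Re_vec z)) \<le> M1"
      "\<And>t. t \<ge> 0 \<Longrightarrow> norm (linear_flow B t (Im_vec z)) \<le> M2"
    using bd[of "Re_vec z"] bd[of "Im_vec z"] by auto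
  show thesis
  proof
    fix t :: real assume "0 \<le> t"
    let ?v = "exp (l * of_real t) *s (z + of_real t *s y)"
    have "exp (Re l * t) * norm (z + of_real t *s y) = norm ?v"
      by (simp only: norm_vector_scalar_mult) simp
    also have "\<dots> \<le> norm (Re_vec ?v) + norm (Im_vec ?v)"
      by (rule norm_le_Re_Im_vec)
    also have "\<dots> \<le> M1 + M2"
      using M[OF \<open>0 \<le> t\<close>] linear_flow_Jordan_chain[OF assms(2,3) \<open>0 \<le> t\<close>] by simp
    finally show "exp (Re l * t) * norm (z + of_real t *s y) \<le> M1 + M2" .
  qed
qed

lemma not_linear_growth:
  assumes "\<And>t. 0 \<le> t \<Longrightarrow> t * a - b \<le> M" shows "(a::real) \<le> 0"
proof (rule ccontr)
  assume "\<not> a \<le> 0"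
  then have "\<bar>M + b\<bar> + 1 - b \<le> M"
    using assms[of "(\<bar>M + b\<bar> + 1) / a"] by simp
  then show False by linarith
qed

text \<open>
  A positive real part contradicts boundedness of \<open>exp (l t) y\<close>; a negative one makes the real and the
  imaginary part of \<open>y\<close> decay to \<open>0\<close>, which a conserved system allows only if both vanish.
\<close>

lemma conserved_eigenvalue_imaginary:
  fixes B :: "real ^ 'n ^ 'n"
  assumes "conserved B" and y: "complexify_matrix B *v y = l *s y" and "y \<noteq> 0"
  shows "Re l = 0"
proof -
  have chain: "complexify_matrix B *v 0 = l *s 0" "complexify_matrix B *v y = l *s y + 0"
    using y by simp_all
  obtain M where M: "\<And>t. 0 \<le> t \<Longrightarrow> exp (Re l * t) * norm y \<le> M"
    using conserved_Jordan_chain_bounded[OF assms(1) chain] by auto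
  have "Re l \<le> 0"
  proof (rule not_linear_growth)
    fix t :: real assume "0 \<le> t"
    have "1 + Re l * t \<le> exp (Re l * t)"
      by (rule exp_ge_add_one_self)
    also have "\<dots> \<le> M / norm y"
      using M[OF \<open>0 \<le> t\<close>] \<open>y \<noteq> 0\<close> by (simp add: field_simps)
    finally show "t * Re l - (- 1) \<le> M / norm y" by (simp add: mult.commute)
  qed
  moreover have "\<not> Re l < 0"
  proof
    assume that: "Re l < 0"
    have "LIM t at_top. (- Re l) * t :> at_top"
      using that by (intro filterlim_tendsto_pos_mult_at_top[OF tendsto_const] filterlim_ident) simp
    then have "((\<lambda>t. exp (Re l * t)) \<longlongrightarrow> 0) at_top"
      by (intro filterlim_compose[OF exp_at_bot]) (simp add: filterlim_uminus_at_bot)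
    then have "((\<lambda>t. exp (Re l * t) * norm y) \<longlongrightarrow> 0) at_top"
      by (intro tendsto_mult_left_zero)
    then have "((\<lambda>t. exp (l * of_real t) *s y) \<longlongrightarrow> 0) at_top"
      by (simp add: tendsto_norm_zero_iff[symmetric, where f = "\<lambda>t. exp (l * of_real t) *s y"]
          norm_vector_scalar_mult)
    note lim0 = this
    have lim: "((\<lambda>t. Re_vec (exp (l * of_real t) *s y)) \<longlongrightarrow> 0) at_top"
       "((\<lambda>t. Im_vec (exp (l * of_real t) *s y)) \<longlongrightarrow> 0) at_top"
      using bounded_linear.tendsto[OF bounded_linear_Re_vec lim0]
        bounded_linear.tendsto[OF bounded_linear_Im_vec lim0]
      by (simp_all only: linear_simps(3)[OF bounded_linear_Re_vec] linear_simps(3)[OF bounded_linear_Im_vec])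
    have ev: "\<forall>\<^sub>F t in at_top. Re_vec (exp (l * of_real t) *s y) = linear_flow B t (Re_vec y)"
      "\<forall>\<^sub>F t in at_top. Im_vec (exp (l * of_real t) *s y) = linear_flow B t (Im_vec y)"
      using linear_flow_Jordan_chain[OF chain] by (simp_all add: eventually_at_top_linorderI[of 0])
    have "Re_vec y = 0" "Im_vec y = 0"
      using Lim_transform_eventually[OF lim(1) ev(1)] Lim_transform_eventually[OF lim(2) ev(2)] assms(1)
      unfolding conserved_def by blast+
    then show False
      using \<open>y \<noteq> 0\<close> Re_Im_vec_eq_0 by blast
  qed
  ultimately show ?thesis by linarith
qed

text \<open>
  As the eigenvalue is imaginary, the solution through \<open>z\<close> has norm \<open>\<bar>z + t y\<bar>\<close>, which is unbounded unless \<open>y = 0\<close>.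
\<close>

lemma conserved_no_Jordan_chain:
  fixes B :: "real ^ 'n ^ 'n"
  assumes "conserved B"
    and y: "complexify_matrix B *v y = l *s y" and z: "complexify_matrix B *v z = l *s z + y"
  shows "y = 0"
proof (rule ccontr)
  assume "y \<noteq> 0"
  then have "Re l = 0"
    using conserved_eigenvalue_imaginary assms by blast
  then obtain M where M: "\<And>t. 0 \<le> t \<Longrightarrow> norm (z + of_real t *s y) \<le> M"
    using conserved_Jordan_chain_bounded[OF assms] by auto
  have "norm y \<le> 0"
  proof (rule not_linear_growth)
    fix t :: real assume t: "0 \<le> t"
    have "t * norm y = norm ((z + of_real t *s y) - z)"
      using t by (simp add: norm_vector_scalar_mult)
    also have "\<dots> \<le> norm (z + of_real t *s y) + norm z"
      by (rule norm_triangle_ineq4)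
    finally show "t * norm y - norm z \<le> M"
      using M[OF t] by linarith
  qed
  with \<open>y \<noteq> 0\<close> show False by simp
qed

definition poly_matrix_act :: "complex ^ 'n ^ 'n \<Rightarrow> complex poly \<Rightarrow> complex ^ 'n \<Rightarrow> complex ^ 'n" where
  "poly_matrix_act A p v = (\<Sum>i\<le>degree p. coeff p i *s (((*v) A) ^^ i) v)"

lemma poly_matrix_act_ge_degree:
  assumes "degree p \<le> n"
  shows "poly_matrix_act A p v = (\<Sum>i\<le>n. coeff p i *s (((*v) A) ^^ i) v)"
  unfolding poly_matrix_act_def
  by (rule sum.mono_neutral_left) (use assms in \<open>auto simp: coeff_eq_0\<close>)

lemma funpow_matrix_diff_scale:
  fixes A :: "complex ^ 'n ^ 'n"
  shows "(((*v) A) ^^ i) (v - c *s w) = (((*v) A) ^^ i) v - c *s (((*v) A) ^^ i) (w :: complex ^ 'n)"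
  by (induction i) (simp_all add: matrix_vector_mult_diff_distrib vector_scalar_commute)

lemma matrix_vector_mult_sum:
  fixes A :: "'a :: comm_ring_1 ^ 'n ^ 'm"
  shows "A *v (\<Sum>i\<in>I. v i) = (\<Sum>i\<in>I. A *v v i)"
  by (induction I rule: infinite_finite_induct) (simp_all add: matrix_vector_right_distrib)

text \<open>
  Lets an induction on the degree peel off one root at a time.
\<close>

lemma poly_matrix_act_linear_factor:
  "poly_matrix_act A ([:- l, 1:] * q) v = poly_matrix_act A q (A *v v - l *s v)"
proof -
  let ?T = "(*v) A" and ?p = "[:- l, 1:] * q" and ?n = "degree q"
  have "poly_matrix_act A ?p v = (\<Sum>i\<le>Suc ?n. coeff ?p i *s (?T ^^ i) v)"
    by (rule poly_matrix_act_ge_degree) (use degree_mult_le[of "[:- l, 1:]" q] in simp)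
  also have "\<dots> = (\<Sum>i\<le>Suc ?n. coeff (pCons 0 q) i *s (?T ^^ i) v) -
      (\<Sum>i\<le>Suc ?n. l *s (coeff q i *s (?T ^^ i) v))"
    by (subst sum_subtractf[symmetric], intro sum.cong) (simp_all add: vec.scale_left_diff_distrib)
  also have "(\<Sum>i\<le>Suc ?n. coeff (pCons 0 q) i *s (?T ^^ i) v) = (\<Sum>i\<le>?n. coeff q i *s (?T ^^ i) (A *v v))"
    by (subst sum.atMost_Suc_shift) (simp add: funpow_swap1)
  also have "(\<Sum>i\<le>Suc ?n. l *s (coeff q i *s (?T ^^ i) v)) = (\<Sum>i\<le>?n. l *s (coeff q i *s (?T ^^ i) v))"
    by (simp add: coeff_eq_0)
  finally show ?thesis
    by (simp add: poly_matrix_act_def funpow_matrix_diff_scale vec.scale_right_diff_distrib sum_subtractf mult_ac)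
qed

text \<open>
  The \<open>2 n + 1\<close> vectors \<open>z, A z, \<dots>\<close> are dependent over the reals in a space of real dimension \<open>2 n\<close>.
\<close>

lemma annihilating_polynomial:
  fixes A :: "complex ^ 'n ^ 'n"
  obtains p where "p \<noteq> 0" "poly_matrix_act A p z = 0"
proof -
  let ?N = "DIM(complex ^ 'n)" and ?g = "\<lambda>i. (((*v) A) ^^ i) z"
  have of_real_scale: "of_real r *s x = r *\<^sub>R x" for r and x :: "complex ^ 'n"
    by (simp add: vec_eq_iff) (simp add: scaleR_conv_of_real)
  have act: "poly_matrix_act A (\<Sum>i\<le>?N. monom (of_real (a i)) i) z = (\<Sum>i\<le>?N. a i *\<^sub>R ?g i)"
    for a :: "nat \<Rightarrow> real"
  proof -
    have c: "coeff (sum (\<lambda>i. monom (complex_of_real (a i)) i) {..?N}) j = (if j \<le> ?N then of_real (a j) else 0)" for j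
      by (simp add: coeff_sum)
    have "degree (\<Sum>i\<le>?N. monom (complex_of_real (a i)) i) \<le> ?N"
      by (rule degree_le) (simp only: c, simp)
    then show ?thesis
      by (subst poly_matrix_act_ge_degree, assumption) (simp only: c, simp add: of_real_scale)
  qed
  \<comment> \<open>Dependence of the set of iterates does not see coincidences among them, which give a relation of their own.\<close>
  obtain a :: "nat \<Rightarrow> real" and j where a: "(\<Sum>i\<le>?N. a i *\<^sub>R ?g i) = 0" "j \<le> ?N" "a j \<noteq> 0"
  proof (cases "inj_on ?g {..?N}")
    case True
    then have "dependent (?g ` {..?N})"
      by (intro dependent_biggerset) (simp add: card_image)
    then obtain u where u: "(\<Sum>v\<in>?g ` {..?N}. u v *\<^sub>R v) = 0" "\<exists>v\<in>?g ` {..?N}. u v \<noteq> 0"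
      by (auto simp: dependent_finite)
    then have "(\<Sum>i\<le>?N. u (?g i) *\<^sub>R ?g i) = 0"
      by (simp only: sum.reindex[OF True] o_def)
    then show thesis
      using that[of "\<lambda>i. u (?g i)"] u(2) by blast
  next
    case False
    then obtain i j where ij: "i \<le> ?N" "j \<le> ?N" "i \<noteq> j" "?g i = ?g j"
      by (auto simp: inj_on_def)
    have "(\<Sum>k\<le>?N. ((if k = i then 1 else 0) - (if k = j then 1 else 0)) *\<^sub>R ?g k) = ?g i - ?g j"
      using ij(1,2) by (simp add: scaleR_diff_left sum_subtractf if_distrib[of "\<lambda>c. c *\<^sub>R _"] cong: if_cong)
    then show thesis
      using that[of "\<lambda>k. (if k = i then 1 else 0) - (if k = j then 1 else 0)" i] ij by simp
  qed
  have "coeff (\<Sum>i\<le>?N. monom (complex_of_real (a i)) i) j \<noteq> 0"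
    using a(2,3) by (simp add: coeff_sum)
  then have "(\<Sum>i\<le>?N. monom (complex_of_real (a i)) i) \<noteq> 0"
    by (metis coeff_0)
  then show thesis
    by (rule that) (simp only: act a(1))
qed

text \<open>
  Induction on the degree of \<open>p\<close>. If \<open>p = (X - m) q\<close>, then \<open>(A - m) z\<close> is annihilated by \<open>q\<close>, hence a sum of
  eigenvectors. Those with eigenvalue \<open>l \<noteq> m\<close> are hit by \<open>A - m\<close> after division by \<open>l - m\<close>; subtracting these
  preimages from \<open>z\<close> leaves a vector \<open>w\<close> with \<open>(A - m) w\<close> an eigenvector for \<open>m\<close>, which is \<open>0\<close> since there are
  no Jordan chains.
\<close>

lemma eigenvector_decomposition_of_annihilated:
  fixes B :: "real ^ 'n ^ 'n"
  assumes "conserved B" "p \<noteq> 0" "poly_matrix_act (complexify_matrix B) p z = 0"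
  shows "\<exists>L c. finite L \<and> (\<forall>l\<in>L. complexify_matrix B *v c l = l *s c l) \<and> z = (\<Sum>l\<in>L. c l)"
  using assms(2,3)
proof (induction "degree p" arbitrary: p z)
  case 0
  then obtain a where "p = [:a:]" "a \<noteq> 0"
    by (metis degree_eq_zeroE pCons_0_0)
  with "0.prems" have "z = 0"
    by (simp add: poly_matrix_act_def)
  then show ?case
    by (intro exI[of _ "{}"]) simp
next
  case (Suc d)
  let ?A = "complexify_matrix B"
  have "\<not> constant (poly p)"
    using Suc.hyps(2) by (simp add: constant_degree)
  then obtain m where "poly p m = 0"
    using Fundamental_Theorem_Algebra.fundamental_theorem_of_algebra by blast
  then obtain q where q: "p = [:- m, 1:] * q"
    using poly_eq_0_iff_dvd by (metis dvdE)
  have "q \<noteq> 0"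
    using q Suc.prems(1) by (metis mult_zero_right)
  moreover have "d = degree q"
    using Suc.hyps(2) \<open>q \<noteq> 0\<close> q by (simp add: degree_mult_eq del: mult_pCons_left)
  moreover have "poly_matrix_act ?A q (?A *v z - m *s z) = 0"
    using Suc.prems(2) unfolding q poly_matrix_act_linear_factor .
  ultimately have "\<exists>L c. finite L \<and> (\<forall>l\<in>L. ?A *v c l = l *s c l) \<and> ?A *v z - m *s z = (\<Sum>l\<in>L. c l)"
    by (intro Suc.hyps(1))
  then obtain L c where L: "finite L" "\<And>l. l \<in> L \<Longrightarrow> ?A *v c l = l *s c l"
    and z: "?A *v z - m *s z = (\<Sum>l\<in>L. c l)"
    by blast
  define w where "w = z - (\<Sum>l\<in>L - {m}. (1 / (l - m)) *s c l)"
  define y where "y = (if m \<in> L then c m else 0)"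
  have y: "?A *v y = m *s y"
    by (simp add: y_def L)
  have "?A *v w - m *s w = (?A *v z - m *s z) -
      (\<Sum>l\<in>L - {m}. ?A *v ((1 / (l - m)) *s c l) - m *s ((1 / (l - m)) *s c l))"
    by (simp add: w_def matrix_vector_mult_diff_distrib vec.scale_right_diff_distrib
        sum_subtractf vec.scale_sum_right matrix_vector_mult_sum)
  also have "(\<Sum>l\<in>L - {m}. ?A *v ((1 / (l - m)) *s c l) - m *s ((1 / (l - m)) *s c l)) = (\<Sum>l\<in>L - {m}. c l)"
  proof (intro sum.cong refl)
    fix l assume l: "l \<in> L - {m}"
    have "?A *v ((1 / (l - m)) *s c l) - m *s ((1 / (l - m)) *s c l) = ((1 / (l - m)) * (l - m)) *s c l"
      using L(2)[of l] l
      by (simp add: vector_scalar_commute vec.scale_left_diff_distrib[symmetric] diff_divide_distrib[symmetric])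
    then show "?A *v ((1 / (l - m)) *s c l) - m *s ((1 / (l - m)) *s c l) = c l"
      using l by simp
  qed
  also have "(?A *v z - m *s z) - (\<Sum>l\<in>L - {m}. c l) = y"
    unfolding z y_def using L(1) by (simp add: sum_diff1)
  finally have w: "?A *v w = m *s w + y"
    by (simp add: algebra_simps)
  have "y = 0"
    by (rule conserved_no_Jordan_chain[OF assms(1) y w])
  define c' where "c' l = (if l = m then w else (1 / (l - m)) *s c l)" for l
  have "z = w + (\<Sum>l\<in>L - {m}. (1 / (l - m)) *s c l)"
    by (simp add: w_def)
  also have "\<dots> = c' m + (\<Sum>l\<in>L - {m}. c' l)"
    by (simp add: c'_def)
  also have "\<dots> = (\<Sum>l\<in>insert m L. c' l)"
    using L(1) by (simp add: sum.insert_remove)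
  finally have "z = (\<Sum>l\<in>insert m L. c' l)" .
  moreover have "?A *v c' l = l *s c' l" if "l \<in> insert m L" for l
    using that L(2)[of l] w \<open>y = 0\<close>
    by (cases "l = m") (simp_all add: c'_def vector_scalar_commute mult_ac)
  ultimately show ?case
    using L(1) by (intro exI[of _ "insert m L"] exI[of _ c']) auto
qed

lemma eigenvector_decomposition:
  fixes B :: "real ^ 'n ^ 'n"
  assumes "conserved B"
  obtains L c where "finite L" "\<And>l. l \<in> L \<Longrightarrow> complexify_matrix B *v c l = l *s c l"
    "\<And>l. l \<in> L \<Longrightarrow> c l \<noteq> 0" "z = (\<Sum>l\<in>L. c l)"
proof -
  obtain p where "p \<noteq> 0" "poly_matrix_act (complexify_matrix B) p z = 0"
    by (rule annihilating_polynomial)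
  then obtain L c where L: "finite L" "\<forall>l\<in>L. complexify_matrix B *v c l = l *s c l" "z = (\<Sum>l\<in>L. c l)"
    using eigenvector_decomposition_of_annihilated[OF assms] by blast
  show thesis
    by (rule that[of "{l \<in> L. c l \<noteq> 0}" c])
      (use L in \<open>auto intro!: sum.mono_neutral_right\<close>)
qed

text \<open>
  Applying \<open>A - m\<close> removes the summand with eigenvalue \<open>m\<close> and scales the others by nonzero factors.
\<close>

lemma eigenvector_sum_eq_0:
  fixes A :: "complex ^ 'n ^ 'n"
  assumes "finite L" "\<And>l. l \<in> L \<Longrightarrow> A *v v l = l *s v l" "(\<Sum>l\<in>L. v l) = 0" "l \<in> L"
  shows "v l = 0"
  using assms
proof (induction L arbitrary: v l rule: finite_induct)
  case (insert m L)
  have ev: "\<And>l. l \<in> L \<Longrightarrow> A *v v l = l *s v l" "A *v v m = m *s v m"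
    using insert.prems(1) by auto
  have sum0: "v m + (\<Sum>l\<in>L. v l) = 0"
    using insert.prems(2) insert.hyps by simp
  have "(\<Sum>l\<in>L. (l - m) *s v l) = (\<Sum>l\<in>L. A *v v l - m *s v l)"
    by (intro sum.cong refl) (simp add: ev vec.scale_left_diff_distrib)
  also have "\<dots> = A *v (v m + (\<Sum>l\<in>L. v l)) - m *s (v m + (\<Sum>l\<in>L. v l))"
    by (simp add: matrix_vector_right_distrib matrix_vector_mult_sum ev(2) vec.scale_right_distrib
        vec.scale_sum_right sum_subtractf)
  finally have "(\<Sum>l\<in>L. (l - m) *s v l) = A *v (v m + (\<Sum>l\<in>L. v l)) - m *s (v m + (\<Sum>l\<in>L. v l))" .
  then have 0: "(\<Sum>l\<in>L. (l - m) *s v l) = 0"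
    by (simp add: sum0)
  have "v l = 0" if "l \<in> L" for l
  proof -
    have "(l - m) *s v l = 0"
      by (rule insert.IH[OF _ 0 that]) (simp only: ev vector_scalar_commute vec.scale_scale mult.commute)
    moreover have "l \<noteq> m"
      using that insert.hyps by auto
    ultimately show ?thesis
      by simp
  qed
  then show ?case
    using sum0 insert.prems(3) by auto
qed simp

section \<open>Integral bases of frequencies and Kronecker's theorem\<close>

text \<open>
  The two conditions say that the \<open>\<theta> i\<close> and the elements of \<open>W\<close> generate the same additive group.
\<close>

definition Z_spans :: "nat set \<Rightarrow> (nat \<Rightarrow> real) \<Rightarrow> real set \<Rightarrow> bool" where
  "Z_spans I \<theta> W \<longleftrightarrow>
     (\<forall>w\<in>W. \<exists>m :: nat \<Rightarrow> int. w = (\<Sum>i\<in>I. of_int (m i) * \<theta> i)) \<and>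
     (\<forall>i\<in>I. \<exists>n :: real \<Rightarrow> int. \<theta> i = (\<Sum>w\<in>W. of_int (n w) * w))"

definition Z_independent :: "nat set \<Rightarrow> (nat \<Rightarrow> real) \<Rightarrow> bool" where
  "Z_independent I \<theta> \<longleftrightarrow>
     (\<forall>a :: nat \<Rightarrow> int. (\<Sum>i\<in>I. of_int (a i) * \<theta> i) = 0 \<longrightarrow> (\<forall>i\<in>I. a i = 0))"

text \<open>
  The change of coefficients that compensates a change of generators: adding \<open>s \<theta>\<^sub>i\<close> to \<open>\<theta>\<^sub>j\<close> is undone by
  subtracting \<open>s a\<^sub>j\<close> from \<open>a\<^sub>i\<close>.
\<close>

lemma sum_transvection:
  fixes \<theta> :: "nat \<Rightarrow> real" and a :: "nat \<Rightarrow> int"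
  assumes "finite I" "i \<in> I" "j \<in> I" "i \<noteq> j"
  shows "(\<Sum>l\<in>I. of_int ((a(i := a i - s * a j)) l) * (\<theta>(j := \<theta> j + of_int s * \<theta> i)) l) =
         (\<Sum>l\<in>I. of_int (a l) * \<theta> l)"
proof -
  have I: "I = insert i (insert j (I - {i, j}))" using assms by auto
  have "(\<Sum>l\<in>I - {i, j}. of_int ((a(i := a i - s * a j)) l) * (\<theta>(j := \<theta> j + of_int s * \<theta> i)) l) =
         (\<Sum>l\<in>I - {i, j}. of_int (a l) * \<theta> l)"
    by (rule sum.cong) auto
  then show ?thesis
    by (subst (1 2) I) (use assms in \<open>simp add: algebra_simps\<close>)
qed

lemma Z_spans_transvection:
  assumes "finite I" "i \<in> I" "j \<in> I" "i \<noteq> j" and \<theta>: "Z_spans I \<theta> W"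
  shows "Z_spans I (\<theta>(j := \<theta> j + of_int s * \<theta> i)) W"
  unfolding Z_spans_def
proof (intro conjI ballI)
  fix w assume "w \<in> W"
  then obtain m :: "nat \<Rightarrow> int" where "w = (\<Sum>i\<in>I. of_int (m i) * \<theta> i)"
    using \<theta> unfolding Z_spans_def by blast
  then show "\<exists>m :: nat \<Rightarrow> int. w = (\<Sum>l\<in>I. of_int (m l) * (\<theta>(j := \<theta> j + of_int s * \<theta> i)) l)"
    using sum_transvection[OF assms(1-4), of m s \<theta>] by (intro exI[of _ "m(i := m i - s * m j)"]) simp
next
  fix l assume l: "l \<in> I"
  obtain n where n: "\<And>l. l \<in> I \<Longrightarrow> \<theta> l = (\<Sum>w\<in>W. of_int (n l w :: int) * w)"
    using \<theta> unfolding Z_spans_def by metis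
  show "\<exists>n :: real \<Rightarrow> int. (\<theta>(j := \<theta> j + of_int s * \<theta> i)) l = (\<Sum>w\<in>W. of_int (n w) * w)"
  proof (cases "l = j")
    case True
    have "\<theta> j + of_int s * \<theta> i = (\<Sum>w\<in>W. of_int (n j w + s * n i w) * w)"
      unfolding n[OF assms(2)] n[OF assms(3)]
      by (simp add: sum.distrib sum_distrib_left algebra_simps)
    then show ?thesis
      using True by (intro exI[of _ "\<lambda>w. n j w + s * n i w"]) simp
  next
    case False
    then show ?thesis using n[OF l] by (intro exI[of _ "n l"]) simp
  qed
qed

text \<open>
  Euclid's algorithm on the coefficients of a relation: adding a multiple \<open>\<plusminus>1\<close> of one
  generator to another decreases the sum of their absolute values, until a single nonzero
  coefficient remains, whose generator is then \<open>0\<close> and can be dropped.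
\<close>

lemma Z_spans_shrink:
  assumes "finite I" "Z_spans I \<theta> W" "(\<Sum>i\<in>I. of_int (a i) * \<theta> i) = 0" "k \<in> I" "(a k :: int) \<noteq> 0"
  shows "\<exists>I' \<theta>'. finite I' \<and> card I' < card I \<and> Z_spans I' \<theta>' W"
  using assms(2-)
proof (induction "nat (\<Sum>i\<in>I. \<bar>a i\<bar>)" arbitrary: \<theta> a k rule: less_induct)
  case less
  show ?case
  proof (cases "\<exists>i\<in>I. \<exists>j\<in>I. i \<noteq> j \<and> a i \<noteq> 0 \<and> a j \<noteq> 0")
    case True
    then obtain i j where ij: "i \<in> I" "j \<in> I" "i \<noteq> j" "a i \<noteq> 0" "a j \<noteq> 0" "\<bar>a j\<bar> \<le> \<bar>a i\<bar>"
      by (metis linear)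
    \<comment> \<open>The sign for which subtracting \<open>s * a j\<close> moves the larger coefficient \<open>a i\<close> towards \<open>0\<close>.\<close>
    define s where "s = sgn (a i) * sgn (a j)"
    let ?a = "a(i := a i - s * a j)" and ?\<theta> = "\<theta>(j := \<theta> j + of_int s * \<theta> i)"
    have "\<bar>a i - s * a j\<bar> < \<bar>a i\<bar>"
      using ij(4-6) by (cases "0 < a i"; cases "0 < a j") (auto simp: s_def)
    then have "(\<Sum>l\<in>I. \<bar>?a l\<bar>) < (\<Sum>l\<in>I. \<bar>a l\<bar>)"
      by (intro sum_strict_mono_ex1) (use assms(1) ij(1) in auto)
    moreover have "0 \<le> (\<Sum>l\<in>I. \<bar>?a l\<bar>)"
      by (intro sum_nonneg) simp
    ultimately have "nat (\<Sum>l\<in>I. \<bar>?a l\<bar>) < nat (\<Sum>l\<in>I. \<bar>a l\<bar>)"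
      by linarith
    then show ?thesis
    proof (rule less.hyps)
      show "Z_spans I ?\<theta> W"
        using Z_spans_transvection assms(1) ij(1-3) less.prems(1) by blast
      show "(\<Sum>l\<in>I. of_int (?a l) * ?\<theta> l) = 0"
        using sum_transvection[OF assms(1) ij(1-3)] less.prems(2) by metis
      show "j \<in> I" "?a j \<noteq> 0"
        using ij by auto
    qed
  next
    case False
    then have "(\<Sum>i\<in>I. of_int (a i) * \<theta> i) = (\<Sum>i\<in>{k}. of_int (a i) * \<theta> i)"
      using less.prems(3,4) assms(1) by (intro sum.mono_neutral_right) auto
    then have "\<theta> k = 0"
      using less.prems(2,4) by simp
    then have drop: "(\<Sum>i\<in>I. of_int (m i) * \<theta> i) = (\<Sum>i\<in>I - {k}. of_int (m i) * \<theta> i)" for m :: "nat \<Rightarrow> int"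
      using assms(1) by (intro sum.mono_neutral_right) auto
    have "Z_spans (I - {k}) \<theta> W"
      using less.prems(1) unfolding Z_spans_def drop by auto
    moreover have "card (I - {k}) < card I"
      using assms(1) less.prems(3) by (intro psubset_card_mono) auto
    ultimately show ?thesis
      using assms(1) by blast
  qed
qed

text \<open>
  A finitely generated subgroup of the reals is free: a generating family of least cardinality admits no relation,
  since \<open>Z_spans_shrink\<close> would make it smaller.
\<close>

lemma Z_basis_exists:
  assumes "finite W"
  obtains k \<theta> where "Z_spans {..<k} \<theta> W" "Z_independent {..<k} \<theta>"
proof -
  let ?P = "\<lambda>n. \<exists>I \<theta>. finite I \<and> card I = n \<and> Z_spans I \<theta> W"
  obtain e where e: "bij_betw e {..<card W} W"
    using ex_bij_betw_nat_finite[OF assms] by (auto simp: atLeast0LessThan)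
  have "Z_spans {..<card W} e W"
    unfolding Z_spans_def
  proof (intro conjI ballI)
    fix w assume "w \<in> W"
    then obtain i where i: "i < card W" "w = e i"
      using e by (auto simp: bij_betw_def)
    then have "w = (\<Sum>j<card W. of_int (if j = i then 1 else 0) * e j)"
      by (simp add: if_distrib[of "\<lambda>x. of_int x * _"] cong: if_cong)
    then show "\<exists>m :: nat \<Rightarrow> int. w = (\<Sum>j<card W. of_int (m j) * e j)"
      by (intro exI)
  next
    fix i assume "i \<in> {..<card W}"
    then have "e i \<in> W"
      using e by (auto simp: bij_betw_def)
    then have "e i = (\<Sum>w\<in>W. of_int (if w = e i then 1 else 0) * w)"
      using assms by (simp add: if_distrib[of "\<lambda>x. of_int x * _"] cong: if_cong)
    then show "\<exists>n :: real \<Rightarrow> int. e i = (\<Sum>w\<in>W. of_int (n w) * w)"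
      by (intro exI)
  qed
  then have "?P (card W)"
    by (intro exI[of _ "{..<card W}"] exI[of _ e]) simp
  then have "?P (LEAST n. ?P n)"
    by (rule LeastI)
  then obtain I \<theta> where I: "finite I" "card I = (LEAST n. ?P n)" "Z_spans I \<theta> W"
    by blast
  have indep: "Z_independent I \<theta>"
    unfolding Z_independent_def
  proof (intro allI impI ballI, rule ccontr)
    fix a :: "nat \<Rightarrow> int" and i
    assume "(\<Sum>i\<in>I. of_int (a i) * \<theta> i) = 0" "i \<in> I" "a i \<noteq> 0"
    then obtain I' \<theta>' where "finite I'" "card I' < card I" "Z_spans I' \<theta>' W"
      using Z_spans_shrink[OF I(1,3)] by blast
    then show False
      using not_less_Least[of "card I'" ?P] I(2) by auto
  qed
  obtain h where h: "bij_betw h {..<card I} I"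
    using ex_bij_betw_nat_finite[OF I(1)] by (auto simp: atLeast0LessThan)
  define g where "g = the_inv_into {..<card I} h"
  have gh: "g (h i) = i" if "i < card I" for i
    using that h unfolding g_def bij_betw_def by (simp add: the_inv_into_f_f)
  have reindex: "(\<Sum>i\<in>I. of_int (m i) * \<theta> i) = (\<Sum>i<card I. of_int (m (h i)) * \<theta> (h i))" for m :: "nat \<Rightarrow> int"
    by (rule sum.reindex_bij_betw[OF h, symmetric])
  show thesis
  proof
    show "Z_spans {..<card I} (\<lambda>i. \<theta> (h i)) W"
      unfolding Z_spans_def
    proof (intro conjI ballI)
      fix w assume "w \<in> W"
      then obtain m :: "nat \<Rightarrow> int" where "w = (\<Sum>i\<in>I. of_int (m i) * \<theta> i)"
        using I(3) unfolding Z_spans_def by blast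
      then show "\<exists>m :: nat \<Rightarrow> int. w = (\<Sum>i<card I. of_int (m i) * \<theta> (h i))"
        unfolding reindex by (rule exI[of _ "\<lambda>i. m (h i)"])
    next
      fix i assume "i \<in> {..<card I}"
      then show "\<exists>n :: real \<Rightarrow> int. \<theta> (h i) = (\<Sum>w\<in>W. of_int (n w) * w)"
        using I(3) bij_betwE[OF h] unfolding Z_spans_def by blast
    qed
    show "Z_independent {..<card I} (\<lambda>i. \<theta> (h i))"
      unfolding Z_independent_def
    proof (intro allI impI ballI)
      fix a :: "nat \<Rightarrow> int" and i
      assume a: "(\<Sum>i<card I. of_int (a i) * \<theta> (h i)) = 0" and i: "i \<in> {..<card I}"
      have "(\<Sum>i\<in>I. of_int (a (g i)) * \<theta> i) = 0"
        unfolding reindex using a by (simp add: gh)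
      then have "\<forall>i\<in>I. a (g i) = 0"
        using indep[unfolded Z_independent_def, rule_format, of "\<lambda>i. a (g i)"] by blast
      then have "a (g (h i)) = 0"
        using bij_betwE[OF h] i by blast
      then show "a i = 0"
        using i by (simp add: gh)
    qed
  qed
qed

lemma Z_independent_inj_on:
  assumes "Z_independent {..<k} \<theta>"
  shows "inj_on \<theta> {..<k}"
proof (rule inj_onI, rule ccontr)
  fix i j assume ij: "i \<in> {..<k}" "j \<in> {..<k}" "\<theta> i = \<theta> j" "i \<noteq> j"
  let ?a = "\<lambda>l. (if l = i then 1 else 0) - (if l = j then 1 else 0) :: int"
  have "(\<Sum>l<k. of_int (?a l) * \<theta> l) = \<theta> i - \<theta> j"
    using ij by (simp add: left_diff_distrib sum_subtractf if_distrib[of "\<lambda>x. x * _"]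
        if_distrib[of of_int] cong: if_cong)
  then have "(\<Sum>l<k. of_int (?a l) * \<theta> l) = 0"
    using ij(3) by simp
  then have "\<forall>l\<in>{..<k}. ?a l = 0"
    by (rule assms[unfolded Z_independent_def, THEN spec, THEN mp])
  then have "?a i = 0"
    using ij(1) by (rule bspec)
  then show False
    using ij(4) by simp
qed

lemma Z_independent_module:
  assumes "Z_independent {..<k} \<theta>"
  shows "module.independent (\<lambda>r. (*) (real_of_int r)) (\<theta> ` {..<k})"
proof -
  interpret Modules.module "(\<lambda>r. (*) (real_of_int r))"
    by (simp add: Modules.module.intro distrib_left mult.commute)
  have inj: "inj_on \<theta> {..<k}"
    by (rule Z_independent_inj_on[OF assms])
  show ?thesis
  proof
    assume "dependent (\<theta> ` {..<k})"
    then obtain T u where T: "finite T" "T \<subseteq> \<theta> ` {..<k}" "(\<Sum>v\<in>T. of_int (u v) * v) = 0" "\<exists>v\<in>T. u v \<noteq> 0"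
      unfolding dependent_explicit by blast
    let ?a = "\<lambda>i. if \<theta> i \<in> T then u (\<theta> i) else 0"
    have "(\<Sum>i<k. of_int (?a i) * \<theta> i) = (\<Sum>v\<in>\<theta> ` {..<k}. of_int (if v \<in> T then u v else 0) * v)"
      by (simp add: sum.reindex[OF inj])
    also have "\<dots> = (\<Sum>v\<in>T. of_int (u v) * v)"
      using T(2) by (intro sum.mono_neutral_cong_right) auto
    finally have "(\<Sum>i<k. of_int (?a i) * \<theta> i) = 0"
      using T(3) by simp
    then have "\<forall>i\<in>{..<k}. ?a i = 0"
      by (rule assms[unfolded Z_independent_def, THEN spec, THEN mp])
    moreover obtain i where "i \<in> {..<k}" "\<theta> i \<in> T" "u (\<theta> i) \<noteq> 0"
      using T(2,4) by blast
    ultimately show False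
      by force
  qed
qed

lemma norm_cis_diff_le: "norm (cis (x + 2 * pi * of_int h) - cis y) \<le> \<bar>x - y\<bar>"
proof -
  have "cis (x + 2 * pi * of_int h) = cis x"
    by (simp add: cis_mult[symmetric] cis_multiple_2pi)
  moreover have "cis x - cis y = cis y * (exp (\<i> * of_real (x - y)) - 1)"
    by (simp only: cis_conv_exp[symmetric] right_diff_distrib cis_mult) simp
  then have "norm (cis x - cis y) = norm (exp (\<i> * of_real (x - y)) - 1)"
    by (simp add: norm_mult)
  then have "norm (cis x - cis y) \<le> \<bar>x - y\<bar>"
    using abs_sin_x_le_abs_x[of "(x - y) / 2"] by (simp only: dist_exp_i_1) simp
  ultimately show ?thesis by simp
qed

text \<open>
  Kronecker's theorem gives some real time \<open>t\<close>, possibly negative. Dirichlet's theorem provides a long time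
  \<open>q S\<close> after which all angles have almost returned; adding it moves \<open>t\<close> beyond \<open>T\<close> at the price of a
  second error of the same size.
\<close>

lemma Kronecker_forward:
  assumes "Z_independent {..<k} \<theta>" "0 < \<epsilon>"
  obtains t where "T \<le> t" "\<And>i. i < k \<Longrightarrow> norm (cis (2 * pi * (t * \<theta> i)) - cis (2 * pi * \<alpha> i)) < \<epsilon>"
proof -
  \<comment> \<open>An error \<open>2 \<delta>\<close> in the winding number is an error of \<open>2 pi (2 \<delta>)\<close> in the angle.\<close>
  define \<delta> where "\<delta> = \<epsilon> / (4 * pi)"
  have "0 < \<delta>"
    using assms(2) by (simp add: \<delta>_def)
  obtain t h where t: "\<And>i. i < k \<Longrightarrow> \<bar>t * \<theta> i - of_int (h i) - \<alpha> i\<bar> < \<delta>"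
    using Kronecker_thm_1[OF Z_independent_module[OF assms(1)] Z_independent_inj_on[OF assms(1)] \<open>0 < \<delta>\<close>]
    by metis
  define S where "S = max 0 (T - t)"
  obtain N :: nat where N: "0 < N" "1 / N < \<delta>"
    by (metis \<open>0 < \<delta>\<close> gr_zeroI inverse_eq_divide real_arch_inverse)
  obtain q p where q: "0 < q" "\<And>i. i < k \<Longrightarrow> \<bar>of_int q * (S * \<theta> i) - of_int (p i)\<bar> < 1 / N"
    using Dirichlet_approx_simult[OF N(1), of k "\<lambda>i. S * \<theta> i"] by metis
  show thesis
  proof
    have "S \<le> of_int q * S"
      using q(1) mult_right_mono[of 1 "of_int q" S] by (simp add: S_def)
    then show "T \<le> t + of_int q * S"
      by (simp add: S_def)
    fix i assume i: "i < k"
    let ?x = "2 * pi * ((t + of_int q * S) * \<theta> i - of_int (h i + p i))"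
    have "norm (cis (?x + 2 * pi * of_int (h i + p i)) - cis (2 * pi * \<alpha> i)) \<le> \<bar>?x - 2 * pi * \<alpha> i\<bar>"
      by (rule norm_cis_diff_le)
    also have "\<dots> = 2 * pi * \<bar>(t * \<theta> i - of_int (h i) - \<alpha> i) + (of_int q * (S * \<theta> i) - of_int (p i))\<bar>"
      by (subst abs_of_pos[of "2 * pi", symmetric], simp, subst abs_mult[symmetric]) (simp add: algebra_simps)
    also have "\<dots> < 2 * pi * (2 * \<delta>)"
      using t[OF i] q(2)[OF i] N(2) by (intro mult_strict_left_mono) auto
    also have "\<dots> = \<epsilon>"
      by (simp add: \<delta>_def)
    finally show "norm (cis (2 * pi * ((t + of_int q * S) * \<theta> i)) - cis (2 * pi * \<alpha> i)) < \<epsilon>"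
      by (simp add: algebra_simps)
  qed
qed

lemma prod_cis_power_int:
  assumes "finite I"
  shows "(\<Prod>i\<in>I. cis (x i) powi m i) = cis (\<Sum>i\<in>I. of_int (m i) * x i)"
  using assms by (induction I rule: finite_induct) (simp_all add: cis_power_int cis_mult)

section \<open>Omega limit sets of conserved systems are tori\<close>

lemma omega_limit_iff:
  fixes \<phi> :: "real \<Rightarrow> 'a :: metric_space \<Rightarrow> 'a"
  shows "y \<in> omega_limit \<phi> x \<longleftrightarrow> (\<forall>T\<ge>0. \<forall>e>0. \<exists>s\<ge>T. dist (\<phi> s x) y < e)"
proof -
  have "(\<exists>v\<in>\<Union>s\<in>{T..}. {\<phi> s x}. dist v y < e) \<longleftrightarrow> (\<exists>s\<ge>T. dist (\<phi> s x) y < e)" for T e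
    by blast
  then show ?thesis
    unfolding omega_limit_def INT_iff closure_approachable by (simp only: atLeast_iff Ball_def)
qed

text \<open>
  Orbits of different flows may be compared: only the distance of the two curves matters.
\<close>

lemma omega_limit_asymptotic:
  fixes \<phi> :: "real \<Rightarrow> 'a :: real_normed_vector \<Rightarrow> 'a"
  assumes "((\<lambda>t. \<phi> t x - (p + \<psi> t z)) \<longlongrightarrow> 0) at_top"
  shows "omega_limit \<phi> x = (\<lambda>y. p + y) ` omega_limit \<psi> z"
proof -
  have close: "\<exists>s\<ge>T. dist (v s) b < e"
    if lim: "((\<lambda>t. u t - v t) \<longlongrightarrow> 0) at_top" and u: "\<forall>T\<ge>0. \<forall>e>0. \<exists>s\<ge>T. dist (u s) b < e"
      and "0 \<le> T" "0 < e" for u v :: "real \<Rightarrow> 'a" and b T e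
  proof -
    have "\<forall>\<^sub>F t in at_top. dist (u t - v t) 0 < e / 2"
      using tendstoD[OF lim, of "e / 2"] \<open>0 < e\<close> by simp
    then obtain T' where T': "\<And>t. T' \<le> t \<Longrightarrow> dist (u t - v t) 0 < e / 2"
      by (auto simp: eventually_at_top_linorder)
    obtain s where s: "max T T' \<le> s" "dist (u s) b < e / 2"
      using u[rule_format, of "max T T'" "e / 2"] \<open>0 \<le> T\<close> \<open>0 < e\<close>
      by (meson half_gt_zero max.coboundedI1)
    have "dist (v s) b \<le> dist (v s) (u s) + dist (u s) b"
      by (rule dist_triangle)
    also have "\<dots> < e"
      using T'[of s] s by (simp add: dist_norm norm_minus_commute)
    finally show ?thesis
      using s(1) by auto
  qed
  have lim': "((\<lambda>t. (p + \<psi> t z) - \<phi> t x) \<longlongrightarrow> 0) at_top"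
    using tendsto_minus[OF assms] by simp
  have "y \<in> omega_limit \<phi> x \<longleftrightarrow> y - p \<in> omega_limit \<psi> z" for y
  proof -
    have "y \<in> omega_limit \<phi> x \<longleftrightarrow> (\<forall>T\<ge>0. \<forall>e>0. \<exists>s\<ge>T. dist (p + \<psi> s z) y < e)"
      unfolding omega_limit_iff using close[OF assms] close[OF lim'] by blast
    also have "\<dots> \<longleftrightarrow> y - p \<in> omega_limit \<psi> z"
      unfolding omega_limit_iff by (simp add: dist_norm algebra_simps)
    finally show ?thesis .
  qed
  moreover have "y \<in> (\<lambda>y. p + y) ` A \<longleftrightarrow> y - p \<in> A" for y A
    by (auto intro!: image_eqI[of _ _ "y - p"])
  ultimately show ?thesis
    by blast
qed

text \<open>
  The torus is parametrized by the angles with respect to an integral basis \<open>\<theta>\<close> of the group of frequencies. The integer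
  matrix \<open>m\<close> writes the frequencies in terms of \<open>\<theta>\<close> and makes the parametrization well defined; the integer matrix
  \<open>n\<close> writes \<open>\<theta>\<close> in terms of the frequencies and makes it injective.
\<close>

lemma conserved_omega_limit_torus:
  fixes B :: "real ^ 'n ^ 'n"
  assumes "conserved B"
  shows "\<exists>k. top_of_set (omega_limit (linear_flow B) z) homeomorphic_space torus k"
proof -
  obtain L c where L: "finite L"
    and ev: "\<And>l. l \<in> L \<Longrightarrow> complexify_matrix B *v c l = l *s c l"
    and c0: "\<And>l. l \<in> L \<Longrightarrow> c l \<noteq> 0" and z: "complexify z = (\<Sum>l\<in>L. c l)"
    using eigenvector_decomposition[OF assms] by metis
  define \<nu> where "\<nu> l = Im l / (2 * pi)" for l
  have l_\<nu>: "l * of_real t = \<i> * of_real (2 * pi * (t * \<nu> l))" if "l \<in> L" for l t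
    using conserved_eigenvalue_imaginary[OF assms ev c0] that by (simp add: complex_eq_iff \<nu>_def)
  have inj: "inj_on \<nu> L"
    using conserved_eigenvalue_imaginary[OF assms ev c0] by (auto simp: inj_on_def \<nu>_def complex_eq_iff)
  obtain k \<theta> where span: "Z_spans {..<k} \<theta> (\<nu> ` L)" and indep: "Z_independent {..<k} \<theta>"
    by (rule Z_basis_exists[OF finite_imageI[OF L]])
  have "\<forall>l\<in>L. \<exists>m :: nat \<Rightarrow> int. \<nu> l = (\<Sum>i<k. of_int (m i) * \<theta> i)"
    using span unfolding Z_spans_def by blast
  from bchoice[OF this] obtain m :: "complex \<Rightarrow> nat \<Rightarrow> int" where m: "\<And>l. l \<in> L \<Longrightarrow> \<nu> l = (\<Sum>i<k. of_int (m l i) * \<theta> i)"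
    by blast
  have "\<forall>i\<in>{..<k}. \<exists>n :: real \<Rightarrow> int. \<theta> i = (\<Sum>w\<in>\<nu> ` L. of_int (n w) * w)"
    using span unfolding Z_spans_def by blast
  from bchoice[OF this] obtain n' :: "nat \<Rightarrow> real \<Rightarrow> int" where n': "\<And>i. i < k \<Longrightarrow> \<theta> i = (\<Sum>w\<in>\<nu> ` L. of_int (n' i w) * w)"
    by auto
  define n where "n i l = n' i (\<nu> l)" for i l
  have n: "\<theta> i = (\<Sum>l\<in>L. of_int (n i l) * \<nu> l)" if "i < k" for i
    using n'[OF that] by (simp add: sum.reindex[OF inj] n_def)
  \<comment> \<open>Writing \<open>\<theta> i\<close> in terms of the frequencies and these again in terms of \<open>\<theta>\<close> must give \<open>\<theta> i\<close> back; compare coefficients.\<close>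
  have nm: "(\<Sum>l\<in>L. n i l * m l j) = (if j = i then 1 else 0)" if ij: "i < k" "j < k" for i j
  proof -
    let ?a = "\<lambda>j. (\<Sum>l\<in>L. n i l * m l j) - (if j = i then 1 else 0)"
    have "\<theta> i = (\<Sum>l\<in>L. of_int (n i l) * (\<Sum>j<k. of_int (m l j) * \<theta> j))"
      using n[OF ij(1)] m by simp
    also have "\<dots> = (\<Sum>l\<in>L. \<Sum>j<k. of_int (n i l * m l j) * \<theta> j)"
      by (simp add: sum_distrib_left mult.assoc)
    also have "\<dots> = (\<Sum>j<k. of_int (\<Sum>l\<in>L. n i l * m l j) * \<theta> j)"
      by (subst sum.swap) (simp add: sum_distrib_right)
    finally have *: "(\<Sum>j<k. of_int (\<Sum>l\<in>L. n i l * m l j) * \<theta> j) = \<theta> i" by simp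
    have "(\<Sum>j<k. of_int (?a j) * \<theta> j) =
        (\<Sum>j<k. of_int (\<Sum>l\<in>L. n i l * m l j) * \<theta> j) - (\<Sum>j<k. if j = i then \<theta> j else 0)"
      by (subst sum_subtractf[symmetric]) (intro sum.cong refl, simp add: left_diff_distrib)
    also have "\<dots> = 0"
      unfolding * using ij(1) by simp
    finally have "(\<Sum>j<k. of_int (?a j) * \<theta> j) = 0" .
    then have "\<forall>j\<in>{..<k}. ?a j = 0"
      by (rule indep[unfolded Z_independent_def, THEN spec, THEN mp])
    then have "?a j = 0"
      by (rule bspec) (use ij(2) in simp)
    then show ?thesis by simp
  qed

  define mon :: "(nat \<Rightarrow> complex) \<Rightarrow> complex \<Rightarrow> complex" where "mon u l = (\<Prod>i<k. u i powi m l i)" for u l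
  define \<Phi> where "\<Phi> u = (\<Sum>l\<in>L. mon u l *s c l)" for u
  define pt :: "(nat \<Rightarrow> real) \<Rightarrow> nat \<Rightarrow> complex" where
    "pt \<alpha> = (\<lambda>i\<in>{..<k}. cis (2 * pi * \<alpha> i))" for \<alpha>
  have top: "topspace (torus k) = (\<Pi>\<^sub>E i\<in>{..<k}. sphere 0 1)"
    by (simp add: torus_def)
  have pt_in: "pt \<alpha> \<in> topspace (torus k)" for \<alpha>
    by (auto simp: top pt_def)
  have pt_ex: "\<exists>\<alpha>. u = pt \<alpha>" if "u \<in> topspace (torus k)" for u
  proof
    show "u = pt (\<lambda>i. Arg (u i) / (2 * pi))"
    proof
      fix i show "u i = pt (\<lambda>i. Arg (u i) / (2 * pi)) i"
      proof (cases "i < k")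
        case True
        then have "norm (u i) = 1" using that by (auto simp: top PiE_iff)
        then have "cis (Arg (u i)) = u i"
          using cis_Arg[of "u i"] by (cases "u i = 0") (auto simp: sgn_div_norm)
        then show ?thesis using True by (simp add: pt_def)
      next
        case False
        then show ?thesis using that by (auto simp: top pt_def PiE_iff extensional_def)
      qed
    qed
  qed
  have mon_pt: "mon (pt \<alpha>) l = cis (2 * pi * (\<Sum>i<k. of_int (m l i) * \<alpha> i))" for \<alpha> l
    using prod_cis_power_int[of "{..<k}" "\<lambda>i. 2 * pi * \<alpha> i" "m l"]
    by (simp add: mon_def pt_def sum_distrib_left mult_ac)
  have \<Phi>_flow: "\<Phi> (pt (\<lambda>i. t * \<theta> i)) = (\<Sum>l\<in>L. exp (l * of_real t) *s c l)" for t
  proof -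
    have "(\<Sum>i<k. of_int (m l i) * (t * \<theta> i)) = t * \<nu> l" if "l \<in> L" for l
      by (simp add: m[OF that] sum_distrib_left mult_ac)
    then show ?thesis
      unfolding \<Phi>_def mon_pt by (intro sum.cong refl) (simp only: l_\<nu> cis_conv_exp)
  qed
  have flow: "Re_vec (\<Phi> (pt (\<lambda>i. t * \<theta> i))) = linear_flow B t z"
      "Im_vec (\<Phi> (pt (\<lambda>i. t * \<theta> i))) = 0" if "0 \<le> t" for t
  proof -
    have chain: "complexify_matrix B *v 0 = l *s 0" "complexify_matrix B *v c l = l *s c l + 0"
      if "l \<in> L" for l
      using ev[OF that] by simp_all
    have sum: "linear_flow B t (\<Sum>l\<in>L. v l) = (\<Sum>l\<in>L. linear_flow B t (v l))" for v :: "complex \<Rightarrow> real ^ 'n"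
      by (simp add: linear_flow_def matrix_vector_mult_sum)
    have "linear_flow B t z = linear_flow B t (Re_vec (complexify z))"
      by simp
    also have "\<dots> = (\<Sum>l\<in>L. Re_vec (exp (l * of_real t) *s c l))"
      unfolding z Re_vec_sum sum using linear_flow_Jordan_chain(1)[OF chain that] by (intro sum.cong) simp_all
    finally show "Re_vec (\<Phi> (pt (\<lambda>i. t * \<theta> i))) = linear_flow B t z"
      by (simp add: \<Phi>_flow Re_vec_sum)
    have "0 = linear_flow B t (Im_vec (complexify z))"
      by (simp add: linear_flow_def)
    also have "\<dots> = (\<Sum>l\<in>L. Im_vec (exp (l * of_real t) *s c l))"
      unfolding z Im_vec_sum sum using linear_flow_Jordan_chain(2)[OF chain that] by (intro sum.cong) simp_all
    finally show "Im_vec (\<Phi> (pt (\<lambda>i. t * \<theta> i))) = 0"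
      by (simp add: \<Phi>_flow Im_vec_sum)
  qed
  \<comment> \<open>Times tending to infinity, so that limits lie in the omega limit set and not only in the closure of the orbit.\<close>
  have dense: "\<exists>s :: nat \<Rightarrow> real. (\<forall>j. real j \<le> s j) \<and>
      (\<lambda>j. \<Phi> (pt (\<lambda>i. s j * \<theta> i))) \<longlonglongrightarrow> \<Phi> (pt \<alpha>)" for \<alpha>
  proof -
    have "\<exists>t\<ge>real j. \<forall>i<k. norm (cis (2 * pi * (t * \<theta> i)) - cis (2 * pi * \<alpha> i)) < inverse (Suc j)" for j
      using Kronecker_forward[OF indep, of "inverse (Suc j)" "real j" \<alpha>]
      by (metis inverse_positive_iff_positive of_nat_0_less_iff zero_less_Suc)
    then obtain s where s: "\<And>j. real j \<le> s j"
        "\<And>j i. i < k \<Longrightarrow> norm (cis (2 * pi * (s j * \<theta> i)) - cis (2 * pi * \<alpha> i)) < inverse (Suc j)"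
      by metis
    have pt_lim: "(\<lambda>j. pt (\<lambda>i. s j * \<theta> i) i) \<longlonglongrightarrow> pt \<alpha> i" if "i < k" for i
    proof (rule LIM_zero_cancel, rule Lim_null_comparison[OF _ LIMSEQ_inverse_real_of_nat])
      show "\<forall>\<^sub>F j in sequentially. norm (pt (\<lambda>i. s j * \<theta> i) i - pt \<alpha> i) \<le> inverse (real (Suc j))"
        using s(2)[OF that] that by (auto simp: pt_def intro!: always_eventually less_imp_le)
    qed
    have nz: "pt \<alpha> i \<noteq> 0" if "i < k" for i
      using that by (simp add: pt_def)
    have "(\<lambda>j. mon (pt (\<lambda>i. s j * \<theta> i)) l) \<longlonglongrightarrow> mon (pt \<alpha>) l" for l
      unfolding mon_def by (intro tendsto_prod tendsto_power_int pt_lim nz) auto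
    then have "(\<lambda>j. \<Phi> (pt (\<lambda>i. s j * \<theta> i))) \<longlonglongrightarrow> \<Phi> (pt \<alpha>)"
      unfolding \<Phi>_def by (intro tendsto_sum vec_tendstoI) (simp add: tendsto_mult_right)
    then show ?thesis
      using s(1) by blast
  qed
  \<comment> \<open>The parametrization is real on the dense line, hence everywhere; so taking real parts loses nothing and injectivity
    can be checked on complex vectors.\<close>
  have real: "Im_vec (\<Phi> (pt \<alpha>)) = 0" for \<alpha>
  proof -
    obtain s where s: "\<And>j. real j \<le> s j" "(\<lambda>j. \<Phi> (pt (\<lambda>i. s j * \<theta> i))) \<longlonglongrightarrow> \<Phi> (pt \<alpha>)"
      using dense by blast
    have "(\<lambda>j. Im_vec (\<Phi> (pt (\<lambda>i. s j * \<theta> i)))) \<longlonglongrightarrow> Im_vec (\<Phi> (pt \<alpha>))"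
      by (rule bounded_linear.tendsto[OF bounded_linear_Im_vec s(2)])
    moreover have "0 \<le> s j" for j
      using s(1)[of j] by linarith
    ultimately show ?thesis
      by (simp add: flow LIMSEQ_const_iff)
  qed

  let ?F = "\<lambda>u. Re_vec (\<Phi> u)"
  have cont: "continuous_map (torus k) euclidean ?F"
    unfolding continuous_map_atin
  proof (intro ballI)
    fix u assume u: "u \<in> topspace (torus k)"
    have "((\<lambda>v. v i) \<longlongrightarrow> u i) (atin (torus k) u)" if "i < k" for i
    proof -
      have "continuous_map (torus k) (top_of_set (sphere 0 1)) (\<lambda>v. v i)"
        unfolding torus_def using that by (intro continuous_map_product_projection) simp
      then have "continuous_map (torus k) euclidean (\<lambda>v. v i)"
        by (simp add: continuous_map_in_subtopology)
      then show ?thesis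
        using u by (simp add: continuous_map_atin)
    qed
    moreover have "u i \<noteq> 0" if "i < k" for i
    proof -
      have "norm (u i) = 1"
        using u that by (auto simp: top PiE_iff)
      then show ?thesis by auto
    qed
    ultimately have "((\<lambda>v. mon v l) \<longlongrightarrow> mon u l) (atin (torus k) u)" for l
      unfolding mon_def by (intro tendsto_prod tendsto_power_int) auto
    then have "(\<Phi> \<longlongrightarrow> \<Phi> u) (atin (torus k) u)"
      unfolding \<Phi>_def by (intro tendsto_sum vec_tendstoI) (simp add: tendsto_mult_right)
    then show "limitin euclidean ?F (?F u) (atin (torus k) u)"
      using bounded_linear.tendsto[OF bounded_linear_Re_vec] by simp
  qed
  have compact: "compact_space (torus k)"
    unfolding torus_def by (simp add: compact_space_product_topology compact_space_subtopology)
  have image: "?F ` topspace (torus k) = omega_limit (linear_flow B) z"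
  proof (intro equalityI subsetI)
    fix y assume "y \<in> ?F ` topspace (torus k)"
    then obtain \<alpha> where y: "y = ?F (pt \<alpha>)"
      using pt_ex by blast
    obtain s where s: "\<And>j. real j \<le> s j" "(\<lambda>j. \<Phi> (pt (\<lambda>i. s j * \<theta> i))) \<longlonglongrightarrow> \<Phi> (pt \<alpha>)"
      using dense by blast
    have "0 \<le> s j" for j
      using s(1)[of j] by linarith
    then have "(\<lambda>j. linear_flow B (s j) z) \<longlonglongrightarrow> y"
      using bounded_linear.tendsto[OF bounded_linear_Re_vec s(2)] by (simp add: flow y)
    show "y \<in> omega_limit (linear_flow B) z"
      unfolding omega_limit_iff
    proof (intro allI impI)
      fix T e :: real assume "0 \<le> T" "0 < e"
      then have "\<forall>\<^sub>F j in sequentially. dist (linear_flow B (s j) z) y < e"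
        using \<open>(\<lambda>j. linear_flow B (s j) z) \<longlonglongrightarrow> y\<close> tendstoD by blast
      moreover have "\<forall>\<^sub>F j in sequentially. T \<le> real j"
        by (rule eventually_ge_at_top[THEN eventually_compose_filterlim]) (rule filterlim_real_sequentially)
      ultimately have "\<forall>\<^sub>F j in sequentially. dist (linear_flow B (s j) z) y < e \<and> T \<le> real j"
        by (rule eventually_conj)
      then obtain j where "dist (linear_flow B (s j) z) y < e" "T \<le> real j"
        using eventually_happens'[OF sequentially_bot] by blast
      then show "\<exists>s\<ge>T. dist (linear_flow B s z) y < e"
        using s(1)[of j] order_trans by blast
    qed
  next
    fix y assume y: "y \<in> omega_limit (linear_flow B) z"
    have "compactin euclidean (?F ` topspace (torus k))"
      using compact cont by (intro image_compactin) (auto simp: compact_space_def)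
    then have "closed (?F ` topspace (torus k))"
      by (simp add: compact_imp_closed)
    moreover have "y \<in> closure (?F ` topspace (torus k))"
      unfolding closure_approachable
    proof (intro allI impI)
      fix e :: real assume "0 < e"
      then obtain s where "0 \<le> s" "dist (linear_flow B s z) y < e"
        using y unfolding omega_limit_iff by blast
      then show "\<exists>x\<in>?F ` topspace (torus k). dist x y < e"
        using flow(1)[of s] pt_in by (metis imageI)
    qed
    ultimately show "y \<in> ?F ` topspace (torus k)"
      by simp
  qed
  have "inj_on ?F (topspace (torus k))"
  proof (rule inj_onI)
    fix u v assume uv: "u \<in> topspace (torus k)" "v \<in> topspace (torus k)" "?F u = ?F v"
    have "\<Phi> u = \<Phi> v"
      using pt_ex[OF uv(1)] pt_ex[OF uv(2)] uv(3) real complexify_Re_vec by metis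
    then have sum0: "(\<Sum>l\<in>L. (mon u l - mon v l) *s c l) = 0"
      by (simp add: \<Phi>_def vec.scale_left_diff_distrib sum_subtractf)
    have mon: "mon u l = mon v l" if "l \<in> L" for l
    proof -
      have "(mon u l - mon v l) *s c l = 0"
        by (rule eigenvector_sum_eq_0[where A = "complexify_matrix B", OF L _ sum0 that])
          (simp only: ev vector_scalar_commute vec.scale_scale mult.commute)
      then show ?thesis
        using c0[OF that] by simp
    qed
    \<comment> \<open>The coordinates are monomials in the values of the characters.\<close>
    have recover: "w i = (\<Prod>l\<in>L. mon w l powi n i l)" if w: "w \<in> topspace (torus k)" and i: "i < k" for w i
    proof -
      obtain \<alpha> where \<alpha>: "w = pt \<alpha>"
        using pt_ex w by blast
      have "(\<Prod>l\<in>L. mon w l powi n i l) = cis (\<Sum>l\<in>L. of_int (n i l) * (2 * pi * (\<Sum>j<k. of_int (m l j) * \<alpha> j)))"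
        unfolding \<alpha> mon_pt by (rule prod_cis_power_int[OF L])
      also have "(\<Sum>l\<in>L. of_int (n i l) * (2 * pi * (\<Sum>j<k. of_int (m l j) * \<alpha> j))) =
          (\<Sum>l\<in>L. \<Sum>j<k. 2 * pi * (of_int (n i l * m l j) * \<alpha> j))"
        by (simp add: sum_distrib_left mult_ac)
      also have "\<dots> = (\<Sum>j<k. 2 * pi * (of_int (\<Sum>l\<in>L. n i l * m l j) * \<alpha> j))"
        by (subst sum.swap) (simp add: sum_distrib_right sum_distrib_left)
      also have "\<dots> = (\<Sum>j<k. if j = i then 2 * pi * \<alpha> j else 0)"
        using i by (intro sum.cong refl) (simp add: nm del: of_int_sum)
      also have "\<dots> = 2 * pi * \<alpha> i"
        using i by simp
      finally have "(\<Prod>l\<in>L. mon w l powi n i l) = cis (2 * pi * \<alpha> i)" .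
      moreover have "w i = cis (2 * pi * \<alpha> i)"
        using i by (simp add: \<alpha> pt_def)
      ultimately show ?thesis
        by (rule trans[rotated, OF sym])
    qed
    have "u i = v i" if "i < k" for i
      using recover[OF uv(1) that] recover[OF uv(2) that] mon by simp
    moreover have "u i = v i" if "\<not> i < k" for i
      using uv(1,2) that by (auto simp: top PiE_iff extensional_def)
    ultimately show "u = v"
      by blast
  qed
  then have "homeomorphic_map (torus k) (top_of_set (omega_limit (linear_flow B) z)) ?F"
    using cont compact image
    by (intro continuous_imp_homeomorphic_map)
      (auto simp: continuous_map_in_subtopology Hausdorff_space_subtopology)
  then have "torus k homeomorphic_space top_of_set (omega_limit (linear_flow B) z)"
    by (rule homeomorphic_map_imp_homeomorphic_space)
  then show ?thesis
    using homeomorphic_space_sym by blast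
qed

section \<open>Norms, strict convexity, and uniqueness of solutions\<close>

lemma is_norm_nonneg: "is_norm N \<Longrightarrow> 0 \<le> N x"
  and is_norm_eq_0_iff: "is_norm N \<Longrightarrow> N x = 0 \<longleftrightarrow> x = 0"
  and is_norm_scaleR: "is_norm N \<Longrightarrow> N (a *\<^sub>R x) = \<bar>a\<bar> * N x"
  and is_norm_triangle: "is_norm N \<Longrightarrow> N (x + y) \<le> N x + N y"
  by (simp_all add: is_norm_def)

lemma is_norm_minus_commute: "is_norm N \<Longrightarrow> N (x - y) = N (y - x)"
  using is_norm_scaleR[of N "- 1" "x - y"] by simp

lemma is_norm_triangle_sub: "is_norm N \<Longrightarrow> N (x - z) \<le> N (x - y) + N (y - z)"
  using is_norm_triangle[of N "x - y" "y - z"] by simp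

lemma is_norm_le_norm:
  fixes N :: "'a :: euclidean_space \<Rightarrow> real"
  assumes "is_norm N"
  obtains C where "0 < C" "\<And>x. N x \<le> C * norm x"
proof
  let ?C = "(\<Sum>b\<in>Basis. N b) + 1"
  show "0 < ?C"
    by (intro add_nonneg_pos sum_nonneg is_norm_nonneg assms) simp
  fix x :: 'a
  have sum: "N (\<Sum>b\<in>A. v b) \<le> (\<Sum>b\<in>A. N (v b))" for A and v :: "'a \<Rightarrow> 'a"
  proof (induction A rule: infinite_finite_induct)
    case (insert b A)
    then show ?case
      using is_norm_triangle[OF assms, of "v b" "sum v A"] by simp
  qed (use is_norm_eq_0_iff[OF assms, of 0] in auto)
  have "N x = N (\<Sum>b\<in>Basis. (x \<bullet> b) *\<^sub>R b)"
    by (simp add: euclidean_representation)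
  also have "\<dots> \<le> (\<Sum>b\<in>Basis. N ((x \<bullet> b) *\<^sub>R b))"
    by (rule sum)
  also have "\<dots> \<le> (\<Sum>b\<in>Basis. norm x * N b)"
    by (intro sum_mono) (simp add: is_norm_scaleR[OF assms] Basis_le_norm is_norm_nonneg[OF assms] mult_right_mono)
  also have "\<dots> = norm x * (\<Sum>b\<in>Basis. N b)"
    by (rule sum_distrib_left[symmetric])
  also have "\<dots> \<le> ?C * norm x"
    by (simp add: algebra_simps)
  finally show "N x \<le> ?C * norm x" .
qed

lemma is_norm_diff_abs: "is_norm N \<Longrightarrow> \<bar>N x - N y\<bar> \<le> N (x - y)"
  using is_norm_triangle[of N "x - y" y] is_norm_triangle[of N "y - x" x] is_norm_minus_commute[of N x y]
  by (simp add: abs_le_iff)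

lemma is_norm_tendsto:
  fixes N :: "'a :: euclidean_space \<Rightarrow> real"
  assumes "is_norm N" "(f \<longlongrightarrow> a) F"
  shows "((\<lambda>x. N (f x)) \<longlongrightarrow> N a) F"
proof -
  obtain C where C: "\<And>x. N x \<le> C * norm x"
    using is_norm_le_norm[OF assms(1)] by blast
  have "((\<lambda>x. C * norm (f x - a)) \<longlongrightarrow> 0) F"
    using assms(2) by (intro tendsto_mult_right_zero tendsto_norm_zero LIM_zero)
  then have "((\<lambda>x. N (f x) - N a) \<longlongrightarrow> 0) F"
    by (rule Lim_null_comparison[rotated])
      (simp add: always_eventually order_trans[OF is_norm_diff_abs[OF assms(1)] C])
  then show ?thesis
    by (rule LIM_zero_cancel)
qed

lemma is_norm_continuous_on:
  fixes N :: "'a :: euclidean_space \<Rightarrow> real"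
  assumes "is_norm N" "continuous_on S f"
  shows "continuous_on S (\<lambda>x. N (f x))"
  using assms by (auto simp: continuous_on_def intro: is_norm_tendsto)

text \<open>
  Compactness of the Euclidean unit sphere gives a positive lower bound for \<open>N\<close> on it.
\<close>

lemma norm_le_is_norm:
  fixes N :: "'a :: euclidean_space \<Rightarrow> real"
  assumes "is_norm N"
  obtains C where "0 < C" "\<And>x. norm x \<le> C * N x"
proof -
  have "compact (sphere 0 1 :: 'a set)" "sphere 0 1 \<noteq> ({} :: 'a set)"
    by simp_all
  from continuous_attains_inf[OF this is_norm_continuous_on[OF assms continuous_on_id]]
  obtain p :: 'a where p: "norm p = 1" "\<And>x. norm x = 1 \<Longrightarrow> N p \<le> N x"
    by auto
  have "p \<noteq> 0"
    using p(1) by auto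
  then have "0 < N p"
    using is_norm_eq_0_iff[OF assms, of p] is_norm_nonneg[OF assms, of p] by simp
  show thesis
  proof
    show "0 < 1 / N p"
      using \<open>0 < N p\<close> by simp
    fix x :: 'a
    show "norm x \<le> 1 / N p * N x"
    proof (cases "x = 0")
      case False
      have "N p \<le> N ((1 / norm x) *\<^sub>R x)"
        using False by (intro p(2)) simp
      then have "N p \<le> N x / norm x"
        using is_norm_scaleR[OF assms, of "1 / norm x" x] by simp
      then show ?thesis
        using False \<open>0 < N p\<close> by (simp add: field_simps)
    qed (use is_norm_nonneg[OF assms, of 0] \<open>0 < N p\<close> in simp)
  qed
qed

lemma is_norm_tendsto_zero_iff:
  fixes N :: "'a :: euclidean_space \<Rightarrow> real"
  assumes "is_norm N"
  shows "((\<lambda>x. N (f x)) \<longlongrightarrow> 0) F \<longleftrightarrow> (f \<longlongrightarrow> 0) F"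
proof
  assume lim: "((\<lambda>x. N (f x)) \<longlongrightarrow> 0) F"
  obtain C where C: "\<And>x. norm x \<le> C * N x"
    using norm_le_is_norm[OF assms] by blast
  show "(f \<longlongrightarrow> 0) F"
    by (rule Lim_null_comparison[OF _ tendsto_mult_right_zero[OF lim, of C]]) (simp add: C)
next
  assume "(f \<longlongrightarrow> 0) F"
  then show "((\<lambda>x. N (f x)) \<longlongrightarrow> 0) F"
    using is_norm_tendsto[OF assms, of f 0 F] is_norm_eq_0_iff[OF assms, of 0] by simp
qed

text \<open>
  Passes from the sphere to the ball: if an end has norm below \<open>r\<close>, already the triangle inequality is strict.
\<close>

lemma strictly_convex_norm_less:
  assumes N: "strictly_convex_norm N" and "N x \<le> r" "N y \<le> r" "x \<noteq> y" and \<alpha>: "0 < \<alpha>" "\<alpha> < 1"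
  shows "N (\<alpha> *\<^sub>R x + (1 - \<alpha>) *\<^sub>R y) < r"
proof (cases "N x = r \<and> N y = r")
  case True
  have isn: "is_norm N"
    using N by (simp add: strictly_convex_norm_def)
  have "r \<noteq> 0"
    using True \<open>x \<noteq> y\<close> is_norm_eq_0_iff[OF isn, of x] is_norm_eq_0_iff[OF isn, of y] by metis
  then have "0 < r"
    using True is_norm_nonneg[OF isn, of x] by simp
  then show ?thesis
    using N True \<open>x \<noteq> y\<close> \<alpha> unfolding strictly_convex_norm_def by blast
next
  case False
  have isn: "is_norm N"
    using N by (simp add: strictly_convex_norm_def)
  have "N (\<alpha> *\<^sub>R x + (1 - \<alpha>) *\<^sub>R y) \<le> \<alpha> * N x + (1 - \<alpha>) * N y"
    using is_norm_triangle[OF isn, of "\<alpha> *\<^sub>R x" "(1 - \<alpha>) *\<^sub>R y"] \<alpha> by (simp add: is_norm_scaleR[OF isn])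
  also have "\<dots> < \<alpha> * r + (1 - \<alpha>) * r"
  proof (cases "N x < r")
    case True
    then show ?thesis
      using \<alpha> assms(3) by (simp add: add_less_le_mono)
  next
    case nx: False
    then have "N x = r" "N y < r"
      using assms(2,3) False by linarith+
    then show ?thesis
      using \<alpha> by simp
  qed
  finally show ?thesis
    by (simp add: algebra_simps)
qed

text \<open>
  Rigidity of segments: \<open>u\<close> and \<open>v\<close>, the velocities from \<open>x\<close> to \<open>p\<close> and from \<open>p\<close> to \<open>y\<close>, have norm at most
  that of their weighted average \<open>y - x\<close>, so they coincide.
\<close>

lemma strictly_convex_norm_between:
  assumes N: "strictly_convex_norm N" and \<alpha>: "0 < \<alpha>" "\<alpha> < 1"
    and "N (p - x) \<le> (1 - \<alpha>) * N (y - x)" "N (y - p) \<le> \<alpha> * N (y - x)"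
  shows "p = \<alpha> *\<^sub>R x + (1 - \<alpha>) *\<^sub>R y"
proof -
  have isn: "is_norm N"
    using N by (simp add: strictly_convex_norm_def)
  define u v where "u = (1 / (1 - \<alpha>)) *\<^sub>R (p - x)" and "v = (1 / \<alpha>) *\<^sub>R (y - p)"
  have "N u = N (p - x) / (1 - \<alpha>)" "N v = N (y - p) / \<alpha>"
    unfolding u_def v_def is_norm_scaleR[OF isn] using \<alpha> by simp_all
  then have "N u \<le> N (y - x)" "N v \<le> N (y - x)"
    using assms(4,5) \<alpha> by (simp_all add: pos_divide_le_eq mult.commute)
  moreover have comb: "\<alpha> *\<^sub>R v + (1 - \<alpha>) *\<^sub>R u = y - x"
    using \<alpha> by (simp add: u_def v_def)
  ultimately have "u = v"
    using strictly_convex_norm_less[OF N, of v "N (y - x)" u \<alpha>] \<alpha> by auto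
  then have "u = y - x"
    using comb by (simp add: scaleR_add_left[symmetric])
  moreover have "p = x + (1 - \<alpha>) *\<^sub>R u"
    using \<alpha> by (simp add: u_def)
  moreover have "x + (1 - \<alpha>) *\<^sub>R (y - x) = \<alpha> *\<^sub>R x + (1 - \<alpha>) *\<^sub>R y"
    by (simp add: scaleR_diff_left scaleR_diff_right)
  ultimately show ?thesis
    by (simp only:)
qed

lemma is_norm_between:
  assumes N: "is_norm N" and "0 < \<alpha>" "\<alpha> < 1"
  shows "N (\<alpha> *\<^sub>R x + (1 - \<alpha>) *\<^sub>R y - x) = (1 - \<alpha>) * N (y - x)"
    and "N (y - (\<alpha> *\<^sub>R x + (1 - \<alpha>) *\<^sub>R y)) = \<alpha> * N (y - x)"
proof -
  have "\<alpha> *\<^sub>R x + (1 - \<alpha>) *\<^sub>R y - x = (1 - \<alpha>) *\<^sub>R (y - x)" "y - (\<alpha> *\<^sub>R x + (1 - \<alpha>) *\<^sub>R y) = \<alpha> *\<^sub>R (y - x)"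
    by (simp_all add: algebra_simps)
  then show "N (\<alpha> *\<^sub>R x + (1 - \<alpha>) *\<^sub>R y - x) = (1 - \<alpha>) * N (y - x)"
    and "N (y - (\<alpha> *\<^sub>R x + (1 - \<alpha>) *\<^sub>R y)) = \<alpha> * N (y - x)"
    using assms by (simp_all only: is_norm_scaleR[OF N])
qed

lemma C1_field_Lipschitz_cball:
  fixes f :: "real ^ 'n \<Rightarrow> real ^ 'n"
  assumes "C1_field f"
  obtains K where "\<And>x y. x \<in> cball 0 R \<Longrightarrow> y \<in> cball 0 R \<Longrightarrow> norm (f x - f y) \<le> K * norm (x - y)"
proof -
  obtain f' :: "real ^ 'n \<Rightarrow> (real ^ 'n) \<Rightarrow>\<^sub>L (real ^ 'n)"
    where f': "\<And>x. (f has_derivative blinfun_apply (f' x)) (at x)" "continuous_on UNIV f'"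
    using assms unfolding C1_field_def by blast
  have "bounded (f' ` cball 0 R)"
    using f'(2) by (intro compact_imp_bounded compact_continuous_image) (auto intro: continuous_on_subset)
  then obtain K where "\<And>x. x \<in> cball 0 R \<Longrightarrow> norm (f' x) \<le> K"
    unfolding bounded_iff by blast
  then have "norm (f x - f y) \<le> K * norm (x - y)" if "x \<in> cball 0 R" "y \<in> cball 0 R" for x y
    using that by (intro differentiable_bound[of "cball 0 R" f "\<lambda>x. blinfun_apply (f' x)"])
      (auto simp: norm_blinfun.rep_eq[symmetric] intro: has_derivative_at_withinI f'(1))
  then show thesis
    by (rule that)
qed

text \<open>
  Gronwall's argument: on a ball containing both solutions \<open>f\<close> has a Lipschitz constant \<open>K\<close>, so
  \<open>exp (- 2 K s) \<bar>u s - v s\<bar>\<^sup>2\<close> is nonincreasing.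
\<close>

lemma C1_field_unique:
  fixes f :: "real ^ 'n \<Rightarrow> real ^ 'n"
  assumes "C1_field f"
    and u: "\<And>s. 0 \<le> s \<Longrightarrow> (u has_vector_derivative f (u s)) (at s within {0..})"
    and v: "\<And>s. 0 \<le> s \<Longrightarrow> (v has_vector_derivative f (v s)) (at s within {0..})"
    and "u 0 = v 0" "0 \<le> t"
  shows "u t = v t"
proof -
  have cont: "continuous_on {0..t} u" "continuous_on {0..t} v"
    using continuous_on_vector_derivative[of "{0..}", OF u] continuous_on_vector_derivative[of "{0..}", OF v]
    by (auto intro: continuous_on_subset)
  then have "bounded (u ` {0..t} \<union> v ` {0..t})"
    by (simp add: compact_imp_bounded compact_continuous_image)
  then obtain R where "\<forall>z\<in>u ` {0..t} \<union> v ` {0..t}. norm z \<le> R"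
    unfolding bounded_iff by blast
  then have R: "\<And>s. s \<in> {0..t} \<Longrightarrow> u s \<in> cball 0 R" "\<And>s. s \<in> {0..t} \<Longrightarrow> v s \<in> cball 0 R"
    by simp_all
  obtain K where K: "\<And>x y. x \<in> cball 0 R \<Longrightarrow> y \<in> cball 0 R \<Longrightarrow> norm (f x - f y) \<le> K * norm (x - y)"
    using C1_field_Lipschitz_cball[OF assms(1)] by blast
  let ?w = "\<lambda>s. u s - v s"
  let ?g = "\<lambda>s. exp (- 2 * K * s) * (?w s \<bullet> ?w s)"
  have "?g t \<le> ?g 0"
  proof (rule DERIV_nonpos_imp_decreasing_open[OF \<open>0 \<le> t\<close>])
    show "continuous_on {0..t} ?g"
      by (intro continuous_intros cont)
    fix s assume s: "0 < s" "s < t"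
    have at: "at s within {0..} = at s"
      by (rule at_within_interior) (use s in simp)
    have w: "(?w has_derivative (\<lambda>h. h *\<^sub>R (f (u s) - f (v s)))) (at s)"
      using has_vector_derivative_diff[OF u[of s] v[of s]] s by (simp add: at has_vector_derivative_def)
    let ?D = "exp (- 2 * K * s) * (2 * (?w s \<bullet> (f (u s) - f (v s)))) +
        exp (- 2 * K * s) * (- 2 * K) * (?w s \<bullet> ?w s)"
    have e: "((\<lambda>s. exp (- 2 * K * s)) has_real_derivative exp (- 2 * K * s) * (- 2 * K)) (at s)"
      by (auto intro!: derivative_eq_intros)
    have "((\<lambda>s. ?w s \<bullet> ?w s) has_real_derivative 2 * (?w s \<bullet> (f (u s) - f (v s)))) (at s)"
      unfolding has_field_derivative_def
      by (rule has_derivative_eq_rhs[OF has_derivative_inner[OF w w]])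
        (simp add: fun_eq_iff inner_commute algebra_simps)
    from DERIV_mult'[OF e this] have "(?g has_real_derivative ?D) (at s)" .
    moreover have "?D \<le> 0"
    proof -
      have "?w s \<bullet> (f (u s) - f (v s)) \<le> norm (?w s) * norm (f (u s) - f (v s))"
        by (rule norm_cauchy_schwarz)
      also have "\<dots> \<le> norm (?w s) * (K * norm (?w s))"
        by (intro mult_left_mono K R) (use s in auto)
      also have "\<dots> = K * (?w s \<bullet> ?w s)"
        by (simp add: dot_square_norm power2_eq_square)
      finally have "?w s \<bullet> (f (u s) - f (v s)) - K * (?w s \<bullet> ?w s) \<le> 0"
        by simp
      then have "2 * exp (- 2 * K * s) * (?w s \<bullet> (f (u s) - f (v s)) - K * (?w s \<bullet> ?w s)) \<le> 0"
        by (intro mult_nonneg_nonpos) auto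
      then show ?thesis
        by (simp add: algebra_simps)
    qed
    ultimately show "\<exists>y. (?g has_real_derivative y) (at s) \<and> y \<le> 0"
      by blast
  qed
  then have "exp (- 2 * K * t) * (?w t \<bullet> ?w t) \<le> 0"
    using \<open>u 0 = v 0\<close> by simp
  then have "?w t \<bullet> ?w t \<le> 0"
    by (simp add: mult_le_0_iff)
  then have "?w t \<bullet> ?w t = 0"
    by (rule antisym[OF _ inner_ge_zero])
  then show ?thesis
    by simp
qed

section \<open>The retraction onto the recurrent points\<close>

locale strictly_nonexpansive_flow =
  fixes f :: "real ^ 'n \<Rightarrow> real ^ 'n"
    and \<phi> :: "real \<Rightarrow> real ^ 'n \<Rightarrow> real ^ 'n"
    and N :: "real ^ 'n \<Rightarrow> real"
  assumes C1: "C1_field f"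
    and flow: "forward_flow f \<phi>"
    and strict: "strictly_convex_norm N"
    and nonexpansive: "nonexpansive_on N UNIV \<phi>"
    and bounded_orbit: "\<exists>x. bounded (trajectory \<phi> x)"
begin

lemma norm_N: "is_norm N"
  using strict by (simp add: strictly_convex_norm_def)

lemma flow_0 [simp]: "\<phi> 0 x = x"
  using flow by (simp add: forward_flow_def)

lemma flow_deriv: "0 \<le> t \<Longrightarrow> ((\<lambda>s. \<phi> s x) has_vector_derivative f (\<phi> t x)) (at t within {0..})"
  using flow by (simp add: forward_flow_def)

lemma flow_add:
  assumes "0 \<le> s" "0 \<le> t"
  shows "\<phi> (s + t) x = \<phi> s (\<phi> t x)"
proof (rule C1_field_unique[OF C1 _ _ _ \<open>0 \<le> s\<close>, where u = "\<lambda>s. \<phi> (s + t) x" and v = "\<lambda>s. \<phi> s (\<phi> t x)"])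
  fix r :: real assume r: "0 \<le> r"
  have "((\<lambda>s. \<phi> s x) has_vector_derivative f (\<phi> (r + t) x)) (at (r + t) within (\<lambda>s. s + t) ` {0..})"
    by (rule has_vector_derivative_within_subset[OF flow_deriv]) (use r \<open>0 \<le> t\<close> in auto)
  moreover have "((\<lambda>s. s + t) has_vector_derivative 1) (at r within {0..})"
    by (auto intro!: derivative_eq_intros)
  ultimately show "((\<lambda>s. \<phi> (s + t) x) has_vector_derivative f (\<phi> (r + t) x)) (at r within {0..})"
    using vector_diff_chain_within[of "\<lambda>s. s + t" 1 r "{0..}" "\<lambda>s. \<phi> s x"] by (simp add: o_def)
qed (simp_all add: flow_deriv)

lemma flow_nonexpansive: "0 \<le> t \<Longrightarrow> N (\<phi> t x - \<phi> t y) \<le> N (x - y)"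
  using nonexpansive by (cases "t = 0") (auto simp: nonexpansive_on_def)

lemma trajectory_bounded: "bounded (trajectory \<phi> x)"
proof -
  obtain y where "bounded (trajectory \<phi> y)"
    using bounded_orbit by blast
  then obtain M where M: "\<And>t. 0 \<le> t \<Longrightarrow> norm (\<phi> t y) \<le> M"
    unfolding bounded_iff trajectory_def by blast
  obtain C where C: "0 < C" "\<And>x. norm x \<le> C * N x"
    using norm_le_is_norm[OF norm_N] by blast
  have "norm (\<phi> t x) \<le> M + C * N (x - y)" if "0 \<le> t" for t
  proof -
    have "norm (\<phi> t x) \<le> norm (\<phi> t y) + norm (\<phi> t x - \<phi> t y)"
      using norm_triangle_ineq[of "\<phi> t y" "\<phi> t x - \<phi> t y"] by simp
    also have "\<dots> \<le> M + C * N (\<phi> t x - \<phi> t y)"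
      using M[OF that] C(2) by (rule add_mono)
    also have "\<dots> \<le> M + C * N (x - y)"
      using flow_nonexpansive[OF that] C(1) by simp
    finally show ?thesis .
  qed
  then show ?thesis
    unfolding bounded_iff trajectory_def by blast
qed

text \<open>
  Continuity in the initial point comes for free from nonexpansiveness.
\<close>

lemma flow_tendsto:
  assumes "(X \<longlongrightarrow> x) F" "0 \<le> t"
  shows "((\<lambda>k. \<phi> t (X k)) \<longlongrightarrow> \<phi> t x) F"
proof -
  have "((\<lambda>k. N (X k - x)) \<longlongrightarrow> 0) F"
    using assms(1) by (simp add: is_norm_tendsto_zero_iff[OF norm_N] LIM_zero)
  then have "((\<lambda>k. N (\<phi> t (X k) - \<phi> t x)) \<longlongrightarrow> 0) F"
    by (rule Lim_null_comparison[rotated])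
      (simp add: always_eventually flow_nonexpansive[OF assms(2)] is_norm_nonneg[OF norm_N])
  then show ?thesis
    by (simp add: is_norm_tendsto_zero_iff[OF norm_N] LIM_zero_cancel)
qed

text \<open>
  A diagonal argument over a countable dense set; nonexpansiveness carries the Cauchy property from
  the dense set to all points.
\<close>

lemma pointwise_convergent_subsequence:
  assumes t: "\<And>k :: nat. 0 \<le> t k"
  obtains r g where "strict_mono (r :: nat \<Rightarrow> nat)" "\<And>x. (\<lambda>k. \<phi> (t (r k)) x) \<longlonglongrightarrow> g x"
proof -
  obtain M where M: "\<And>s x. 0 \<le> s \<Longrightarrow> norm (\<phi> s x) \<le> M x"
  proof -
    have "\<forall>x. \<exists>M. \<forall>s\<ge>0. norm (\<phi> s x) \<le> M"
      using trajectory_bounded unfolding bounded_iff trajectory_def by blast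
    from choice[OF this] show thesis
      using that by blast
  qed
  have M_nonneg: "0 \<le> M x" for x
    using order_trans[OF norm_ge_zero M[of 0 x]] by simp
  obtain D :: "(real ^ 'n) set" where D: "countable D" "\<And>X. open X \<Longrightarrow> X \<noteq> {} \<Longrightarrow> \<exists>d\<in>D. d \<in> X"
    by (rule countable_dense_setE) blast
  \<comment> \<open>The bounds differ from orbit to orbit; rescaling makes them uniform over the dense set.\<close>
  have "norm ((1 / (M x + 1)) *\<^sub>R \<phi> (t k) x) \<le> 1" for k x
    using M[OF t, of k x] M_nonneg[of x] by simp
  from function_convergent_subsequence[OF D(1), of "\<lambda>k x. (1 / (M x + 1)) *\<^sub>R \<phi> (t k) x" 1, OF this]
  obtain r where r: "strict_mono r"
      "\<And>x. x \<in> D \<Longrightarrow> \<exists>l. (\<lambda>k. (1 / (M x + 1)) *\<^sub>R \<phi> (t (r k)) x) \<longlonglongrightarrow> l"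
    by blast
  have conv_D: "Cauchy (\<lambda>k. \<phi> (t (r k)) x)" if "x \<in> D" for x
  proof -
    obtain l where "(\<lambda>k. (1 / (M x + 1)) *\<^sub>R \<phi> (t (r k)) x) \<longlonglongrightarrow> l"
      using r(2)[OF \<open>x \<in> D\<close>] by blast
    from tendsto_scaleR[OF tendsto_const[of "M x + 1"] this]
    have "(\<lambda>k. \<phi> (t (r k)) x) \<longlonglongrightarrow> (M x + 1) *\<^sub>R l"
      using M_nonneg[of x] by simp
    then show ?thesis
      by (rule LIMSEQ_imp_Cauchy)
  qed
  obtain C1 where C1: "0 < C1" "\<And>x. N x \<le> C1 * norm x"
    using is_norm_le_norm[OF norm_N] by blast
  obtain C2 where C2: "0 < C2" "\<And>x. norm x \<le> C2 * N x"
    using norm_le_is_norm[OF norm_N] by blast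
  have "Cauchy (\<lambda>k. \<phi> (t (r k)) x)" for x
  proof (rule metric_CauchyI)
    fix e :: real assume "0 < e"
    define \<delta> where "\<delta> = e / (3 * C2 * C1)"
    have "0 < \<delta>"
      using \<open>0 < e\<close> C1(1) C2(1) by (simp add: \<delta>_def)
    then obtain d where d: "d \<in> D" "dist x d < \<delta>"
      using D(2)[of "ball x \<delta>"] by auto
    have xd: "norm (\<phi> (t (r k)) x - \<phi> (t (r k)) d) \<le> e / 3" for k
    proof -
      have "norm (\<phi> (t (r k)) x - \<phi> (t (r k)) d) \<le> C2 * N (\<phi> (t (r k)) x - \<phi> (t (r k)) d)"
        by (rule C2(2))
      also have "\<dots> \<le> C2 * (C1 * norm (x - d))"
        using order_trans[OF flow_nonexpansive[OF t] C1(2)] C2(1) by (intro mult_left_mono) auto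
      also have "\<dots> \<le> C2 * (C1 * \<delta>)"
        using d(2) C1(1) C2(1) by (simp add: dist_norm)
      also have "\<dots> = e / 3"
        using C1(1) C2(1) by (simp add: \<delta>_def)
      finally show ?thesis .
    qed
    obtain K where K: "\<And>m n. K \<le> m \<Longrightarrow> K \<le> n \<Longrightarrow> dist (\<phi> (t (r m)) d) (\<phi> (t (r n)) d) < e / 3"
      using metric_CauchyD[OF conv_D[OF d(1)], of "e / 3"] \<open>0 < e\<close> by auto
    have "dist (\<phi> (t (r m)) x) (\<phi> (t (r n)) x) < e" if "K \<le> m" "K \<le> n" for m n
    proof -
      have "dist (\<phi> (t (r m)) x) (\<phi> (t (r n)) x) \<le> dist (\<phi> (t (r m)) x) (\<phi> (t (r m)) d) +
          dist (\<phi> (t (r m)) d) (\<phi> (t (r n)) d) + dist (\<phi> (t (r n)) d) (\<phi> (t (r n)) x)"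
        using dist_triangle[of "\<phi> (t (r m)) x" "\<phi> (t (r n)) x" "\<phi> (t (r m)) d"]
          dist_triangle[of "\<phi> (t (r m)) d" "\<phi> (t (r n)) x" "\<phi> (t (r n)) d"] by linarith
      then show ?thesis
        using K[OF that] xd[of m] xd[of n] by (simp add: dist_norm norm_minus_commute)
    qed
    then show "\<exists>K. \<forall>m\<ge>K. \<forall>n\<ge>K. dist (\<phi> (t (r m)) x) (\<phi> (t (r n)) x) < e"
      by blast
  qed
  then have "\<exists>l. (\<lambda>k. \<phi> (t (r k)) x) \<longlonglongrightarrow> l" for x
    by (simp add: Cauchy_convergent_iff convergent_def)
  then obtain g where "\<And>x. (\<lambda>k. \<phi> (t (r k)) x) \<longlonglongrightarrow> g x"
    by metis
  with r(1) show thesis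
    by (rule that)
qed

definition limit_retraction :: "(nat \<Rightarrow> real) \<Rightarrow> (real ^ 'n \<Rightarrow> real ^ 'n) \<Rightarrow> bool" where
  "limit_retraction \<sigma> e \<longleftrightarrow> (\<forall>k. real k \<le> \<sigma> k) \<and> (\<forall>x. (\<lambda>k. \<phi> (\<sigma> k) x) \<longlonglongrightarrow> e x) \<and>
     (\<forall>x. e (e x) = e x) \<and> (\<forall>x. ((\<lambda>t. \<phi> t x - \<phi> t (e x)) \<longlongrightarrow> 0) at_top)"

text \<open>
  Let \<open>g\<close> be a pointwise limit of \<open>\<phi> (r k)\<close>. Since \<open>\<phi> (r k) x\<close> and \<open>\<phi> (r (p k)) x\<close> are both close to
  \<open>g x\<close>, the gap \<open>s k = r (p k) - r k\<close> nearly fixes \<open>g x\<close>. A subsequence of the gaps converges pointwise to a map \<open>e\<close>,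
  and then \<open>e (g x) = g x\<close>. As \<open>e\<close> commutes with the flow and thus with \<open>g\<close>, also \<open>g (e x) = g x\<close>: the distance between the
  orbits of \<open>x\<close> and \<open>e x\<close>, which never increases, tends to \<open>0\<close> along \<open>r\<close>, hence altogether. Taking the
  limit along \<open>\<sigma>\<close> instead yields \<open>e x = e (e x)\<close>.
\<close>

lemma limit_retraction_exists: "\<exists>\<sigma> e. limit_retraction \<sigma> e"
proof -
  obtain r g where r: "strict_mono (r :: nat \<Rightarrow> nat)" and g: "\<And>x. (\<lambda>k. \<phi> (real (r k)) x) \<longlonglongrightarrow> g x"
    using pointwise_convergent_subsequence[of real] by auto
  have r_ge: "k \<le> r k" for k
    by (rule strict_mono_imp_increasing[OF r])
  \<comment> \<open>Since \<open>r (p k) \<ge> p k\<close>, this choice makes the gap at least \<open>k\<close>.\<close>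
  define p where "p k = r k + k" for k
  define s where "s k = real (r (p k)) - real (r k)" for k
  have s_ge: "real k \<le> s k" for k
    using r_ge[of "p k"] by (simp add: s_def p_def)
  have p_lim: "filterlim p at_top sequentially"
    by (rule filterlim_at_top_mono[OF filterlim_ident]) (simp add: p_def)
  have s_lim: "(\<lambda>k. \<phi> (s k) (g x)) \<longlonglongrightarrow> g x" for x
  proof -
    have "N (\<phi> (s k) (g x) - g x) \<le> N (g x - \<phi> (real (r k)) x) + N (\<phi> (real (r (p k))) x - g x)" for k
    proof -
      have s0: "0 \<le> s k"
        using s_ge[of k] by linarith
      have "\<phi> (real (r (p k))) x = \<phi> (s k) (\<phi> (real (r k)) x)"
        using flow_add[OF s0, of "real (r k)" x] by (simp add: s_def)
      then have "N (\<phi> (s k) (g x) - \<phi> (real (r (p k))) x) \<le> N (g x - \<phi> (real (r k)) x)"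
        using flow_nonexpansive[OF s0, of "g x" "\<phi> (real (r k)) x"] by (simp only:)
      then show ?thesis
        using is_norm_triangle_sub[OF norm_N, of "\<phi> (s k) (g x)" "g x" "\<phi> (real (r (p k))) x"]
        by linarith
    qed
    moreover have "(\<lambda>k. N (g x - \<phi> (real (r k)) x) + N (\<phi> (real (r (p k))) x - g x)) \<longlonglongrightarrow> 0 + 0"
    proof (intro tendsto_add)
      show "(\<lambda>k. N (g x - \<phi> (real (r k)) x)) \<longlonglongrightarrow> 0"
        unfolding is_norm_tendsto_zero_iff[OF norm_N]
        using tendsto_diff[OF tendsto_const[of "g x"] g[of x]] by simp
      show "(\<lambda>k. N (\<phi> (real (r (p k))) x - g x)) \<longlonglongrightarrow> 0"
        unfolding is_norm_tendsto_zero_iff[OF norm_N]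
        by (rule LIM_zero[OF filterlim_compose[OF g p_lim]])
    qed
    ultimately have "(\<lambda>k. N (\<phi> (s k) (g x) - g x)) \<longlonglongrightarrow> 0"
      by (intro Lim_null_comparison[where g = "\<lambda>k. N (g x - \<phi> (real (r k)) x) + N (\<phi> (real (r (p k))) x - g x)"
            and f = "\<lambda>k. N (\<phi> (s k) (g x) - g x)"])
        (simp_all only: real_norm_def abs_of_nonneg[OF is_norm_nonneg[OF norm_N]] eventually_True add_0)
    then show ?thesis
      by (simp add: is_norm_tendsto_zero_iff[OF norm_N] LIM_zero_cancel)
  qed
  have "0 \<le> s k" for k
    using s_ge[of k] by linarith
  then obtain q e where q: "strict_mono (q :: nat \<Rightarrow> nat)" and e: "\<And>x. (\<lambda>k. \<phi> (s (q k)) x) \<longlonglongrightarrow> e x"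
    using pointwise_convergent_subsequence[of s] by auto
  define \<sigma> where "\<sigma> k = s (q k)" for k
  have \<sigma>_ge: "real k \<le> \<sigma> k" for k
    using s_ge[of "q k"] strict_mono_imp_increasing[OF q, of k] by (simp add: \<sigma>_def)
  have \<sigma>_nonneg: "0 \<le> \<sigma> k" for k
    using \<sigma>_ge[of k] by linarith
  have \<sigma>: "(\<lambda>k. \<phi> (\<sigma> k) x) \<longlonglongrightarrow> e x" for x
    using e by (simp add: \<sigma>_def)
  have e_g: "e (g x) = g x" for x
    using LIMSEQ_unique[OF e[of "g x"]] LIMSEQ_subseq_LIMSEQ[OF s_lim[of x] q] by (simp add: o_def)
  have e_flow: "e (\<phi> t x) = \<phi> t (e x)" if "0 \<le> t" for t x
  proof -
    have "\<phi> (\<sigma> k) (\<phi> t x) = \<phi> t (\<phi> (\<sigma> k) x)" for k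
      using flow_add[OF that \<sigma>_nonneg, of k x] flow_add[OF \<sigma>_nonneg that, of k x] by (simp add: add.commute)
    then show ?thesis
      using LIMSEQ_unique[OF \<sigma>[of "\<phi> t x"]] flow_tendsto[OF \<sigma>[of x] that] by simp
  qed
  have e_nonexp: "N (e x - e y) \<le> N (x - y)" for x y
    by (rule LIMSEQ_le_const2[OF is_norm_tendsto[OF norm_N tendsto_diff[OF \<sigma>[of x] \<sigma>[of y]]]])
      (simp add: flow_nonexpansive \<sigma>_nonneg)
  have g_e: "g (e x) = g x" for x
  proof -
    have "(\<lambda>k. N (\<phi> (real (r k)) x - g x)) \<longlonglongrightarrow> 0"
      using g[of x] by (simp add: is_norm_tendsto_zero_iff[OF norm_N] LIM_zero)
    then have "(\<lambda>k. N (e (\<phi> (real (r k)) x) - e (g x))) \<longlonglongrightarrow> 0"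
      by (rule Lim_null_comparison[rotated])
        (simp add: always_eventually e_nonexp is_norm_nonneg[OF norm_N])
    then have "(\<lambda>k. \<phi> (real (r k)) (e x)) \<longlonglongrightarrow> g x"
      by (simp add: is_norm_tendsto_zero_iff[OF norm_N] LIM_zero_cancel e_g e_flow)
    then show ?thesis
      using LIMSEQ_unique[OF g[of "e x"]] by simp
  qed
  have attract: "((\<lambda>t. \<phi> t x - \<phi> t (e x)) \<longlongrightarrow> 0) at_top" for x
  proof -
    have "(\<lambda>k. N (\<phi> (real (r k)) x - \<phi> (real (r k)) (e x))) \<longlonglongrightarrow> 0"
      using tendsto_diff[OF g[of x] g[of "e x"]] by (simp add: is_norm_tendsto_zero_iff[OF norm_N] g_e)
    have "((\<lambda>t. N (\<phi> t x - \<phi> t (e x))) \<longlongrightarrow> 0) at_top"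
      unfolding tendsto_iff
    proof (intro allI impI)
      fix \<epsilon> :: real assume "0 < \<epsilon>"
      then have "\<forall>\<^sub>F k in sequentially. dist (N (\<phi> (real (r k)) x - \<phi> (real (r k)) (e x))) 0 < \<epsilon>"
        using \<open>(\<lambda>k. N (\<phi> (real (r k)) x - \<phi> (real (r k)) (e x))) \<longlonglongrightarrow> 0\<close> tendstoD by blast
      then obtain k where k: "N (\<phi> (real (r k)) x - \<phi> (real (r k)) (e x)) < \<epsilon>"
        using eventually_happens'[OF sequentially_bot] by (auto simp: is_norm_nonneg[OF norm_N])
      show "\<forall>\<^sub>F t in at_top. dist (N (\<phi> t x - \<phi> t (e x))) 0 < \<epsilon>"
      proof (rule eventually_at_top_linorderI[of "real (r k)"])
        fix t assume t: "real (r k) \<le> t"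
        have "\<phi> t y = \<phi> (t - real (r k)) (\<phi> (real (r k)) y)" for y
          using flow_add[of "t - real (r k)" "real (r k)" y] t by simp
        then have "N (\<phi> t x - \<phi> t (e x)) \<le> N (\<phi> (real (r k)) x - \<phi> (real (r k)) (e x))"
          using flow_nonexpansive t by simp
        then show "dist (N (\<phi> t x - \<phi> t (e x))) 0 < \<epsilon>"
          using k by (simp add: is_norm_nonneg[OF norm_N])
      qed
    qed
    then show ?thesis
      by (simp add: is_norm_tendsto_zero_iff[OF norm_N])
  qed
  have "e (e x) = e x" for x
  proof -
    have "filterlim \<sigma> at_top sequentially"
      by (rule filterlim_at_top_mono[OF filterlim_real_sequentially]) (simp add: \<sigma>_ge)
    from filterlim_compose[OF attract this, of x]
    have "e x - e (e x) = 0"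
      using LIMSEQ_unique tendsto_diff[OF \<sigma>[of x] \<sigma>[of "e x"]] by blast
    then show ?thesis by simp
  qed
  then have "limit_retraction \<sigma> e"
    unfolding limit_retraction_def using \<sigma>_ge \<sigma> attract by blast
  then show ?thesis
    by blast
qed

end

section \<open>The flow on the recurrent points\<close>

locale retracted_flow = strictly_nonexpansive_flow f \<phi> N
  for f :: "real ^ 'n \<Rightarrow> real ^ 'n" and \<phi> N +
  fixes \<sigma> :: "nat \<Rightarrow> real" and e :: "real ^ 'n \<Rightarrow> real ^ 'n"
  assumes e: "limit_retraction \<sigma> e"
begin

lemma return_ge: "real k \<le> \<sigma> k"
  and return_tendsto: "(\<lambda>k. \<phi> (\<sigma> k) x) \<longlonglongrightarrow> e x"
  and retraction_idem: "e (e x) = e x"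
  and retraction_attracts: "((\<lambda>t. \<phi> t x - \<phi> t (e x)) \<longlongrightarrow> 0) at_top"
  using e by (simp_all add: limit_retraction_def)

lemma return_nonneg: "0 \<le> \<sigma> k"
  using return_ge[of k] by linarith

lemma retraction_nonexpansive: "N (e x - e y) \<le> N (x - y)"
  by (rule LIMSEQ_le_const2[OF is_norm_tendsto[OF norm_N tendsto_diff[OF return_tendsto return_tendsto]]])
    (simp add: flow_nonexpansive return_nonneg)

lemma retraction_flow:
  assumes "0 \<le> t"
  shows "e (\<phi> t x) = \<phi> t (e x)"
proof -
  have "\<phi> (\<sigma> k) (\<phi> t x) = \<phi> t (\<phi> (\<sigma> k) x)" for k
    using flow_add[OF assms return_nonneg, of k x] flow_add[OF return_nonneg assms, of k x]
    by (simp add: add.commute)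
  then show ?thesis
    using LIMSEQ_unique[OF return_tendsto[of "\<phi> t x"]] flow_tendsto[OF return_tendsto[of x] assms] by simp
qed

text \<open>
  The distance never increases, yet returns to its initial value along \<open>\<sigma>\<close>.
\<close>

lemma flow_isometry:
  assumes "e x = x" "e y = y" "0 \<le> t"
  shows "N (\<phi> t x - \<phi> t y) = N (x - y)"
proof (rule antisym)
  show "N (\<phi> t x - \<phi> t y) \<le> N (x - y)"
    by (rule flow_nonexpansive[OF assms(3)])
  have "(\<lambda>k. N (\<phi> (\<sigma> k) x - \<phi> (\<sigma> k) y)) \<longlonglongrightarrow> N (x - y)"
    using is_norm_tendsto[OF norm_N tendsto_diff[OF return_tendsto[of x] return_tendsto[of y]]] assms
    by simp
  moreover have "N (\<phi> (\<sigma> k) x - \<phi> (\<sigma> k) y) \<le> N (\<phi> t x - \<phi> t y)" if "nat \<lceil>t\<rceil> \<le> k" for k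
  proof -
    have "t \<le> \<sigma> k"
      using that return_ge[of k] by linarith
    then have "\<phi> (\<sigma> k) z = \<phi> (\<sigma> k - t) (\<phi> t z)" for z
      using flow_add[of "\<sigma> k - t" t z] assms(3) by simp
    then show ?thesis
      using flow_nonexpansive \<open>t \<le> \<sigma> k\<close> by simp
  qed
  ultimately show "N (x - y) \<le> N (\<phi> t x - \<phi> t y)"
    by - (rule LIMSEQ_le_const2, assumption, blast)
qed

text \<open>
  The image of a point of the segment under the nonexpansive map \<open>e\<close> is no farther from the fixed ends than the point itself.
\<close>

lemma retract_convex:
  assumes "e x = x" "e y = y" and \<alpha>: "0 < \<alpha>" "\<alpha> < 1"
  shows "e (\<alpha> *\<^sub>R x + (1 - \<alpha>) *\<^sub>R y) = \<alpha> *\<^sub>R x + (1 - \<alpha>) *\<^sub>R y"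
proof (rule strictly_convex_norm_between[OF strict \<alpha>])
  let ?m = "\<alpha> *\<^sub>R x + (1 - \<alpha>) *\<^sub>R y"
  show "N (e ?m - x) \<le> (1 - \<alpha>) * N (y - x)"
    using retraction_nonexpansive[of ?m x] by (simp only: assms(1) is_norm_between[OF norm_N \<alpha>])
  show "N (y - e ?m) \<le> \<alpha> * N (y - x)"
    using retraction_nonexpansive[of y ?m] by (simp only: assms(2) is_norm_between[OF norm_N \<alpha>])
qed

text \<open>
  Same argument as for convexity, with the ends moved isometrically instead of fixed.
\<close>

lemma flow_affine:
  assumes "e x = x" "e y = y" "0 \<le> t" and \<alpha>: "0 < \<alpha>" "\<alpha> < 1"
  shows "\<phi> t (\<alpha> *\<^sub>R x + (1 - \<alpha>) *\<^sub>R y) = \<alpha> *\<^sub>R \<phi> t x + (1 - \<alpha>) *\<^sub>R \<phi> t y"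
proof (rule strictly_convex_norm_between[OF strict \<alpha>])
  let ?m = "\<alpha> *\<^sub>R x + (1 - \<alpha>) *\<^sub>R y"
  have iso: "N (\<phi> t y - \<phi> t x) = N (y - x)"
    by (rule flow_isometry[OF assms(2,1,3)])
  show "N (\<phi> t ?m - \<phi> t x) \<le> (1 - \<alpha>) * N (\<phi> t y - \<phi> t x)"
    using flow_nonexpansive[OF assms(3), of ?m x] by (simp only: iso is_norm_between[OF norm_N \<alpha>])
  show "N (\<phi> t y - \<phi> t ?m) \<le> \<alpha> * N (\<phi> t y - \<phi> t x)"
    using flow_nonexpansive[OF assms(3), of y ?m] by (simp only: iso is_norm_between[OF norm_N \<alpha>])
qed

lemma retraction_fixes_equilibria:
  assumes "\<And>t. 0 \<le> t \<Longrightarrow> \<phi> t x = x"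
  shows "e x = x"
proof -
  have "(\<lambda>k. \<phi> (\<sigma> k) x) = (\<lambda>k. x)"
    using assms return_nonneg by blast
  then show ?thesis
    using return_tendsto[of x] by (simp add: LIMSEQ_const_iff)
qed

text \<open>
  The closed orbit \<open>K\<close> of a recurrent point has a Chebyshev centre: a point \<open>c\<close> minimizing the radius
  \<open>r c\<close> of the smallest ball around \<open>c\<close> that contains \<open>K\<close>. Recurrence makes \<open>K\<close> invariant, so \<open>\<phi> t\<close> does not
  increase \<open>r\<close> and maps a centre to a centre. By strict convexity the midpoint of two centres would have a smaller
  radius, so the centre is unique and fixed by the flow.
\<close>

lemma fixed_point_exists:
  obtains xs where "\<And>t. 0 \<le> t \<Longrightarrow> \<phi> t xs = xs"
proof -
  obtain x where x: "e x = x"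
    using retraction_idem by blast
  define K where "K = closure (trajectory \<phi> x)"
  have K: "compact K"
    by (simp add: K_def trajectory_bounded)
  have flow_K: "\<phi> t x \<in> K" if "0 \<le> t" for t
  proof -
    have "\<phi> t x \<in> trajectory \<phi> x"
      using that unfolding trajectory_def by blast
    then show ?thesis
      unfolding K_def by (rule subsetD[OF closure_subset])
  qed
  have "x \<in> K"
    using flow_K[of 0] by simp
  have contN: "continuous_on A (\<lambda>y. N (y - c))" "continuous_on A (\<lambda>c. N (y - c))" for A c y
    by (intro is_norm_continuous_on[OF norm_N] continuous_intros)+
  define r where "r c = (SUP y\<in>K. N (y - c))" for c
  have attained: "\<exists>y\<in>K. r c = N (y - c) \<and> (\<forall>y'\<in>K. N (y' - c) \<le> r c)" for c
  proof -
    obtain y where y: "y \<in> K" "\<And>y'. y' \<in> K \<Longrightarrow> N (y' - c) \<le> N (y - c)"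
      using continuous_attains_sup[OF K _ contN(1)[of K c]] \<open>x \<in> K\<close> by blast
    then have "r c = N (y - c)"
      unfolding r_def by (intro cSup_eq_maximum) auto
    then show ?thesis
      using y by auto
  qed
  have r_ge: "N (y - c) \<le> r c" if "y \<in> K" for y c
    using attained[of c] that by blast
  have r_Lipschitz: "r c \<le> r c' + N (c - c')" for c c'
  proof -
    obtain y where y: "y \<in> K" "r c = N (y - c)"
      using attained by blast
    then show ?thesis
      using is_norm_triangle_sub[OF norm_N, of y c c'] r_ge[OF y(1), of c']
        is_norm_minus_commute[OF norm_N, of c c'] by linarith
  qed
  have "continuous_on A r" for A
    unfolding continuous_on_def
  proof
    fix c assume "c \<in> A"
    have "((\<lambda>c'. N (c' - c)) \<longlongrightarrow> 0) (at c within A)"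
      unfolding is_norm_tendsto_zero_iff[OF norm_N] by (rule LIM_zero) (rule tendsto_ident_at)
    moreover have "\<bar>r c' - r c\<bar> \<le> N (c' - c)" for c'
      using r_Lipschitz[of c c'] r_Lipschitz[of c' c] is_norm_minus_commute[OF norm_N, of c c'] by (simp add: abs_le_iff)
    ultimately have "((\<lambda>c'. r c' - r c) \<longlongrightarrow> 0) (at c within A)"
      by (intro Lim_null_comparison[where g = "\<lambda>c'. N (c' - c)" and f = "\<lambda>c'. r c' - r c"]) simp_all
    then show "(r \<longlongrightarrow> r c) (at c within A)"
      by (rule LIM_zero_cancel)
  qed
  \<comment> \<open>Outside this ball \<open>r\<close> exceeds \<open>r x\<close>, so a minimum over the ball is global.\<close>
  moreover have "compact {c. N (x - c) \<le> r x}"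
  proof -
    have "closed {c. N (x - c) \<le> r x}"
      by (intro closed_Collect_le contN continuous_on_const)
    moreover have "bounded {c. N (x - c) \<le> r x}"
    proof -
      obtain C where C: "0 < C" "\<And>x. norm x \<le> C * N x"
        using norm_le_is_norm[OF norm_N] by blast
      have "dist x c \<le> C * r x" if "N (x - c) \<le> r x" for c
        using order_trans[OF C(2)[of "x - c"] mult_left_mono[OF that less_imp_le[OF C(1)]]]
        by (simp add: dist_norm)
      then show ?thesis
        unfolding bounded_def by blast
    qed
    ultimately show ?thesis
      by (simp add: compact_eq_bounded_closed)
  qed
  moreover have "x \<in> {c. N (x - c) \<le> r x}"
    using r_ge[OF \<open>x \<in> K\<close>, of x] by simp
  ultimately obtain xs where xs: "N (x - xs) \<le> r x" "\<And>c. N (x - c) \<le> r x \<Longrightarrow> r xs \<le> r c"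
    using continuous_attains_inf[of "{c. N (x - c) \<le> r x}" r] by blast
  have min: "r xs \<le> r c" for c
  proof (cases "N (x - c) \<le> r x")
    case False
    then have "r x \<le> r c"
      using r_ge[OF \<open>x \<in> K\<close>, of c] by linarith
    moreover have "r xs \<le> r x"
      using xs(2)[of x] \<open>x \<in> {c. N (x - c) \<le> r x}\<close> by simp
    ultimately show ?thesis by linarith
  qed (rule xs(2))
  \<comment> \<open>By recurrence every point of \<open>K\<close> is close to the image under \<open>\<phi> t\<close> of a point \<open>\<phi> s' x\<close> of the orbit.\<close>
  have r_flow: "r (\<phi> t c) \<le> r c" if t: "0 \<le> t" for t c
  proof -
    obtain y where y: "y \<in> K" "r (\<phi> t c) = N (y - \<phi> t c)"
      using attained by blast
    have "N (y - \<phi> t c) \<le> r c"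
    proof (rule field_le_epsilon)
      fix \<epsilon> :: real assume "0 < \<epsilon>"
      obtain C where C: "0 < C" "\<And>x. N x \<le> C * norm x"
        using is_norm_le_norm[OF norm_N] by blast
      have "0 < \<epsilon> / 2 / C"
        using \<open>0 < \<epsilon>\<close> C(1) by simp
      then obtain s where s: "0 \<le> s" "dist (\<phi> s x) y < \<epsilon> / 2 / C"
        using y(1) unfolding K_def closure_approachable trajectory_def by blast
      have ys: "N (y - \<phi> s x) < \<epsilon> / 2"
      proof -
        have "N (y - \<phi> s x) \<le> C * norm (y - \<phi> s x)"
          by (rule C(2))
        also have "\<dots> < C * (\<epsilon> / 2 / C)"
          using s(2) C(1) by (intro mult_strict_left_mono) (simp_all add: dist_norm norm_minus_commute)
        finally show ?thesis
          using C(1) by simp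
      qed
      have "(\<lambda>k. N (\<phi> (\<sigma> k) x - x)) \<longlonglongrightarrow> 0"
        unfolding is_norm_tendsto_zero_iff[OF norm_N] using LIM_zero[OF return_tendsto[of x]] by (simp only: x)
      then have "\<forall>\<^sub>F k in sequentially. N (\<phi> (\<sigma> k) x - x) < \<epsilon> / 2"
        by (rule order_tendstoD(2)) (use \<open>0 < \<epsilon>\<close> in simp)
      then obtain k0 where k0: "\<And>k. k0 \<le> k \<Longrightarrow> N (\<phi> (\<sigma> k) x - x) < \<epsilon> / 2"
        by (auto simp: eventually_sequentially)
      define k where "k = max k0 (nat \<lceil>t\<rceil>)"
      have k: "N (\<phi> (\<sigma> k) x - x) < \<epsilon> / 2"
        by (rule k0) (simp add: k_def)
      have "t \<le> \<sigma> k"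
        using return_ge[of k] by (simp add: k_def) linarith
      define s' where "s' = s + \<sigma> k - t"
      have "0 \<le> s'"
        using s(1) \<open>t \<le> \<sigma> k\<close> by (simp add: s'_def)
      have split: "\<phi> s (\<phi> (\<sigma> k) x) = \<phi> t (\<phi> s' x)"
        using flow_add[OF s(1) return_nonneg, of k x] flow_add[OF t \<open>0 \<le> s'\<close>, of x] by (simp add: s'_def)
      have "N (\<phi> s x - \<phi> t (\<phi> s' x)) < \<epsilon> / 2"
        using flow_nonexpansive[OF s(1), of x "\<phi> (\<sigma> k) x"] k is_norm_minus_commute[OF norm_N, of x "\<phi> (\<sigma> k) x"]
        unfolding split by linarith
      moreover have "N (\<phi> t (\<phi> s' x) - \<phi> t c) \<le> r c"
        using flow_nonexpansive[OF t, of "\<phi> s' x" c] r_ge[OF flow_K[OF \<open>0 \<le> s'\<close>], of c] by linarith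
      ultimately show "N (y - \<phi> t c) \<le> r c + \<epsilon>"
        using ys is_norm_triangle_sub[OF norm_N, of y "\<phi> t c" "\<phi> s x"]
          is_norm_triangle_sub[OF norm_N, of "\<phi> s x" "\<phi> t c" "\<phi> t (\<phi> s' x)"] by linarith
    qed
    then show ?thesis
      using y(2) by simp
  qed
  have "\<phi> t xs = xs" if t: "0 \<le> t" for t
  proof (rule ccontr)
    assume ne: "\<phi> t xs \<noteq> xs"
    define m where "m = (1/2) *\<^sub>R \<phi> t xs + (1 - 1/2) *\<^sub>R xs"
    obtain y where y: "y \<in> K" "r m = N (y - m)"
      using attained by blast
    have "N ((1/2) *\<^sub>R (y - \<phi> t xs) + (1 - 1/2) *\<^sub>R (y - xs)) < r xs"
    proof (rule strictly_convex_norm_less[OF strict])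
      show "N (y - \<phi> t xs) \<le> r xs"
        using r_ge[OF y(1), of "\<phi> t xs"] r_flow[OF t, of xs] by linarith
      show "N (y - xs) \<le> r xs"
        by (rule r_ge[OF y(1)])
      show "y - \<phi> t xs \<noteq> y - xs"
        using ne by simp
    qed simp_all
    moreover have "(1/2) *\<^sub>R (y - \<phi> t xs) + (1 - 1/2) *\<^sub>R (y - xs) = y - m"
    proof -
      have "y = (1/2) *\<^sub>R y + (1/2) *\<^sub>R y"
        by (simp add: scaleR_add_left[symmetric])
      then show ?thesis
        by (simp add: m_def algebra_simps)
    qed
    ultimately show False
      using min[of m] y(2) by simp
  qed
  then show thesis
    by (rule that)
qed

text \<open>
  As \<open>\<phi> t\<close> is affine on the segment from \<open>xs\<close> to a recurrent point \<open>x\<close>, so is its time derivative \<open>f\<close> at \<open>t = 0\<close>.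
  Hence the increment of \<open>f\<close> along the segment is the directional derivative of \<open>f\<close> at the end \<open>xs\<close>, and \<open>A\<close> is the
  derivative of \<open>f\<close> there.
\<close>

lemma linearization:
  assumes xs: "\<And>t. 0 \<le> t \<Longrightarrow> \<phi> t xs = xs"
  obtains A where "linear A" "\<And>x. e x = x \<Longrightarrow> f x = A (x - xs)"
proof -
  have deriv_unique: "a = b"
    if "(u has_vector_derivative a) (at 0 within {0..1})" "(v has_vector_derivative b) (at 0 within {0..1})"
      "\<And>s :: real. 0 \<le> s \<Longrightarrow> s \<le> 1 \<Longrightarrow> u s = v s" for u v :: "real \<Rightarrow> real ^ 'n" and a b
  proof -
    have "(u has_vector_derivative b) (at 0 within {0..1})"
      by (rule has_vector_derivative_transform[OF _ _ that(2)]) (use that(3) in auto)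
    then show ?thesis
      using vector_derivative_unique_within_closed_interval[of 0 1 0 u a b] that(1) by simp
  qed
  have deriv_flow: "((\<lambda>t. \<phi> t x) has_vector_derivative f x) (at 0 within {0..1})" for x
    using has_vector_derivative_within_subset[OF flow_deriv[of 0 x], of "{0..1}"] by auto
  have e_xs: "e xs = xs"
    by (rule retraction_fixes_equilibria[OF xs])
  have f_xs: "f xs = 0"
    by (rule deriv_unique[OF deriv_flow has_vector_derivative_const]) (simp add: xs)
  have homogeneous: "f (xs + h *\<^sub>R (x - xs)) = h *\<^sub>R f x" if x: "e x = x" and h: "0 \<le> h" "h \<le> 1" for x h
  proof -
    consider "h = 0" | "h = 1" | "0 < h" "h < 1"
      using h by linarith
    then show ?thesis
    proof cases
      case 3
      have "((\<lambda>t. h *\<^sub>R \<phi> t x + (1 - h) *\<^sub>R xs) has_vector_derivative h *\<^sub>R f x) (at 0 within {0..1})"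
        by (auto intro!: derivative_eq_intros deriv_flow)
      then have "f (h *\<^sub>R x + (1 - h) *\<^sub>R xs) = h *\<^sub>R f x"
        by (rule deriv_unique[OF deriv_flow]) (simp add: flow_affine[OF x e_xs _ 3] xs)
      moreover have "h *\<^sub>R x + (1 - h) *\<^sub>R xs = xs + h *\<^sub>R (x - xs)"
        by (simp add: algebra_simps)
      ultimately show ?thesis by simp
    qed (use f_xs in simp_all)
  qed
  obtain f' :: "real ^ 'n \<Rightarrow> (real ^ 'n) \<Rightarrow>\<^sub>L (real ^ 'n)"
    where f': "\<And>x. (f has_derivative blinfun_apply (f' x)) (at x)"
    using C1 unfolding C1_field_def by blast
  let ?A = "blinfun_apply (f' xs)"
  have "f x = ?A (x - xs)" if x: "e x = x" for x
  proof (rule deriv_unique[symmetric])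
    have "((\<lambda>h. xs + h *\<^sub>R (x - xs)) has_derivative (\<lambda>h. h *\<^sub>R (x - xs))) (at 0)"
      by (auto intro!: derivative_eq_intros)
    moreover have "(f has_derivative ?A) (at (xs + 0 *\<^sub>R (x - xs)))"
      using f'[of xs] by simp
    ultimately have "((\<lambda>h. f (xs + h *\<^sub>R (x - xs))) has_derivative (\<lambda>h. ?A (h *\<^sub>R (x - xs)))) (at 0)"
      by (rule has_derivative_compose)
    then show "((\<lambda>h. f (xs + h *\<^sub>R (x - xs))) has_vector_derivative ?A (x - xs)) (at 0 within {0..1})"
      by (simp add: has_vector_derivative_def blinfun.scaleR_right has_derivative_at_withinI)
    show "((\<lambda>h. h *\<^sub>R f x) has_vector_derivative f x) (at 0 within {0..1})"
      by (auto intro!: derivative_eq_intros)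
  qed (rule homogeneous[OF x])
  moreover have "linear ?A"
    by (rule bounded_linear.linear[OF blinfun.bounded_linear_right])
  ultimately show thesis
    using that by blast
qed

text \<open>
  The recurrent points form a convex set, so two differences, scaled to positive coefficients, add up to
  a multiple of a difference of convex combinations. The point of this form of the span is that all its vectors are multiples of
  single differences, whose norms the flow preserves.
\<close>

lemma cone_of_differences_subspace: "subspace {c *\<^sub>R (a - b) | c a b. e a = a \<and> e b = b}" (is "subspace ?V")
proof (rule subspaceI)
  obtain a where "e a = a"
    using retraction_idem by blast
  then show "0 \<in> ?V"
    by (auto intro!: exI[of _ 0] exI[of _ a])
next
  have pos: "\<exists>c a b. v = c *\<^sub>R (a - b) \<and> 0 < c \<and> e a = a \<and> e b = b" if V: "v \<in> ?V" for v
  proof -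
    obtain c a b where v: "v = c *\<^sub>R (a - b)" "e a = a" "e b = b"
      using V by blast
    consider "c = 0" | "0 < c" | "c < 0"
      by linarith
    then show ?thesis
    proof cases
      case 1
      then have "v = 1 *\<^sub>R (a - a)" using v by simp
      then show ?thesis using v(2) by (metis zero_less_one)
    next
      case 3
      then have "v = (- c) *\<^sub>R (b - a)" "0 < - c" using v by (simp_all add: algebra_simps)
      then show ?thesis using v by blast
    qed (use v in blast)
  qed
  fix v w assume "v \<in> ?V" "w \<in> ?V"
  from pos[OF this(1)] pos[OF this(2)] obtain c a b d a' b' where
    v: "v = c *\<^sub>R (a - b)" "0 < c" "e a = a" "e b = b" and
    w: "w = d *\<^sub>R (a' - b')" "0 < d" "e a' = a'" "e b' = b'"
    by blast
  define \<alpha> where "\<alpha> = c / (c + d)"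
  have \<alpha>: "0 < \<alpha>" "\<alpha> < 1"
    using v(2) w(2) by (simp_all add: \<alpha>_def)
  have cd: "(c + d) * \<alpha> = c" "(c + d) * (1 - \<alpha>) = d"
    using v(2) w(2) by (simp_all add: \<alpha>_def field_simps)
  have "v + w = (c + d) *\<^sub>R ((\<alpha> *\<^sub>R a + (1 - \<alpha>) *\<^sub>R a') - (\<alpha> *\<^sub>R b + (1 - \<alpha>) *\<^sub>R b'))"
    unfolding scaleR_diff_right scaleR_add_right scaleR_scaleR cd v(1) w(1) by simp
  then show "v + w \<in> ?V"
    using retract_convex[OF v(3) w(3) \<alpha>] retract_convex[OF v(4) w(4) \<alpha>] by blast
next
  fix c v assume "v \<in> ?V"
  then obtain d a b where "v = d *\<^sub>R (a - b)" "e a = a" "e b = b"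
    by blast
  then have "c *\<^sub>R v = (c * d) *\<^sub>R (a - b)"
    by simp
  with \<open>e a = a\<close> \<open>e b = b\<close> show "c *\<^sub>R v \<in> ?V"
    by blast
qed

text \<open>
  \<open>B\<close> is the linearization on the span \<open>V\<close> of the differences of recurrent points and \<open>0\<close> on the orthogonal
  complement, so its flow is an isometry for \<open>N\<close> on \<open>V\<close> and the identity on the complement.
\<close>

lemma conserved_linear_conjugate:
  obtains B xs where "conserved B"
    "\<And>x t. e x = x \<Longrightarrow> 0 \<le> t \<Longrightarrow> \<phi> t x = xs + linear_flow B t (x - xs)"
proof -
  obtain xs where xs: "\<And>t. 0 \<le> t \<Longrightarrow> \<phi> t xs = xs"
    by (rule fixed_point_exists) blast
  obtain A where A: "linear A" "\<And>x. e x = x \<Longrightarrow> f x = A (x - xs)"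
    using linearization[OF xs] by blast
  have e_xs: "e xs = xs"
    by (rule retraction_fixes_equilibria[OF xs])
  define V where "V = {c *\<^sub>R (a - b) | c a b. e a = a \<and> e b = b}"
  have V: "subspace V"
    unfolding V_def by (rule cone_of_differences_subspace)
  obtain S where S: "S \<subseteq> V" "pairwise orthogonal S" "\<And>b. b \<in> S \<Longrightarrow> norm b = 1" "independent S" "span S = V"
    using orthonormal_basis_subspace[OF V] by metis
  have "finite S"
    using S(4) by (rule independent_imp_finite)
  define P where "P x = (\<Sum>b\<in>S. (x \<bullet> b) *\<^sub>R b)" for x
  have P: "linear P"
    unfolding P_def by (intro linearI) (simp_all add: inner_add_left scaleR_add_left sum.distrib scaleR_sum_right)
  have P_id: "P v = v" if "v \<in> V" for v
    unfolding P_def using orthonormal_basis_expand[OF S(2,3) _ \<open>finite S\<close>] that S(5) by blast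
  have P_V: "P x \<in> V" for x
    unfolding P_def using S(1) V by (intro subspace_sum subspace_scale) auto
  have diff_V: "x - xs \<in> V" if "e x = x" for x
    unfolding V_def using that e_xs by (intro CollectI exI[of _ 1] exI[of _ x] exI[of _ xs]) simp
  define B where "B = matrix (\<lambda>x. A (P x))"
  have B: "B *v x = A (P x)" for x
    unfolding B_def using matrix_works[of "A \<circ> P"] linear_compose[OF P A(1)] by (simp add: o_def)
  have conj: "\<phi> t x - xs = linear_flow B t (x - xs)" if x: "e x = x" and t: "0 \<le> t" for x t
  proof -
    have "((\<lambda>s. (\<phi> s x - xs) $ i) has_real_derivative (B *v (\<phi> s x - xs)) $ i) (at s within {0..})"
      if "0 \<le> s" for s i
    proof -
      have "e (\<phi> s x) = \<phi> s x"
        using retraction_flow[OF that, of x] x by simp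
      then have "f (\<phi> s x) = B *v (\<phi> s x - xs)"
        by (simp add: A(2) B P_id diff_V)
      then have "((\<lambda>s. \<phi> s x - xs) has_vector_derivative B *v (\<phi> s x - xs)) (at s within {0..})"
        using has_vector_derivative_diff[OF flow_deriv[OF that, of x] has_vector_derivative_const[of xs]] by simp
      from bounded_linear.has_vector_derivative[OF bounded_linear_vec_nth this, of i]
      show ?thesis
        by (simp only: has_real_derivative_iff_has_vector_derivative)
    qed
    from linear_flow_unique[OF this t] show ?thesis
      by simp
  qed
  have V_isometry: "N (linear_flow B t v) = N v" "linear_flow B t v \<in> V" if v: "v \<in> V" and t: "0 \<le> t" for t v
  proof -
    obtain c a b where cab: "v = c *\<^sub>R (a - b)" "e a = a" "e b = b"
      using v unfolding V_def by blast
    have "v = c *\<^sub>R (a - xs) + (- c) *\<^sub>R (b - xs)"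
      by (simp add: cab(1) algebra_simps)
    then have "linear_flow B t v = c *\<^sub>R (\<phi> t a - xs) + (- c) *\<^sub>R (\<phi> t b - xs)"
      by (simp only: linear_flow_add linear_flow_scaleR conj[OF cab(2) t] conj[OF cab(3) t])
    then have lin: "linear_flow B t v = c *\<^sub>R (\<phi> t a - \<phi> t b)"
      by (simp add: algebra_simps)
    then show "N (linear_flow B t v) = N v"
      by (simp only: cab(1) is_norm_scaleR[OF norm_N] flow_isometry[OF cab(2,3) t])
    have "e (\<phi> t a) = \<phi> t a" "e (\<phi> t b) = \<phi> t b"
      using retraction_flow[OF t] cab(2,3) by simp_all
    then show "linear_flow B t v \<in> V"
      unfolding lin V_def by blast
  qed
  have fixed: "linear_flow B t w = w" if "P w = 0" "0 \<le> t" for t w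
    using linear_flow_unique[of "\<lambda>_. w" B t] that linear_0[OF A(1)] by (simp add: B)
  have P_compl: "P (x - P x) = 0" for x
    by (simp add: linear_diff[OF P] P_id P_V)
  have split: "linear_flow B t x = linear_flow B t (P x) + (x - P x)" if "0 \<le> t" for t x
    using linear_flow_add[of B t "P x" "x - P x"] fixed[OF P_compl that] by simp
  have "bounded (trajectory (linear_flow B) z)" for z
  proof -
    obtain C where C: "0 < C" "\<And>x. norm x \<le> C * N x"
      using norm_le_is_norm[OF norm_N] by blast
    have "norm (linear_flow B t z) \<le> C * N (P z) + norm (z - P z)" if "0 \<le> t" for t
      using norm_triangle_ineq[of "linear_flow B t (P z)" "z - P z"] C(2)[of "linear_flow B t (P z)"]
      by (simp only: split[OF that, of z] V_isometry(1)[OF P_V that])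
    then show ?thesis
      unfolding bounded_iff trajectory_def by blast
  qed
  moreover have "z = 0" if lim: "((\<lambda>t. linear_flow B t z) \<longlongrightarrow> 0) at_top" for z
  proof -
    have ev: "\<forall>\<^sub>F t :: real in at_top. 0 \<le> t"
      by (rule eventually_ge_at_top)
    have "((\<lambda>t. N (P (linear_flow B t z))) \<longlongrightarrow> 0) at_top"
      unfolding is_norm_tendsto_zero_iff[OF norm_N]
      using bounded_linear.tendsto[OF linear_conv_bounded_linear[THEN iffD1, OF P] lim] by (simp add: linear_0[OF P])
    moreover have "\<forall>\<^sub>F t in at_top. N (P (linear_flow B t z)) = N (P z)"
      using ev
    proof eventually_elim
      case (elim t)
      have "P (linear_flow B t z) = linear_flow B t (P z)"
        unfolding split[OF elim, of z] linear_add[OF P] P_compl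
        by (simp add: P_id V_isometry(2)[OF P_V elim])
      then show ?case
        by (simp only: V_isometry(1)[OF P_V elim])
    qed
    ultimately have "((\<lambda>t :: real. N (P z)) \<longlongrightarrow> 0) at_top"
      by (rule Lim_transform_eventually)
    then have "P z = 0"
      by (simp add: tendsto_const_iff is_norm_eq_0_iff[OF norm_N])
    have "\<forall>\<^sub>F t in at_top. linear_flow B t z = z"
      using ev by eventually_elim (rule fixed[OF \<open>P z = 0\<close>])
    with lim have "((\<lambda>t :: real. z) \<longlongrightarrow> 0) at_top"
      by (rule Lim_transform_eventually)
    then show ?thesis
      by (simp add: tendsto_const_iff)
  qed
  ultimately have "conserved B"
    unfolding conserved_def by blast
  moreover have "\<phi> t x = xs + linear_flow B t (x - xs)" if "e x = x" "0 \<le> t" for x t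
    using conj[OF that] by (simp add: algebra_simps)
  ultimately show thesis
    by (rule that)
qed

end

theorem theorem1:
  fixes f :: "real ^ 'n \<Rightarrow> real ^ 'n"
    and \<phi> :: "real \<Rightarrow> real ^ 'n \<Rightarrow> real ^ 'n"
    and N :: "real ^ 'n \<Rightarrow> real"
  assumes "C1_field f"
    and "forward_flow f \<phi>"
    and "strictly_convex_norm N"
    and "nonexpansive_on N UNIV \<phi>"
    and "\<exists>x. bounded (trajectory \<phi> x)"
  shows "(\<forall>x0. bounded (trajectory \<phi> x0)) \<and>
         (\<exists>(B :: real ^ 'n ^ 'n) (xstar :: real ^ 'n). conserved B \<and>
            (\<forall>x0. \<exists>z0. omega_limit \<phi> x0 = (\<lambda>z. xstar + z) ` omega_limit (linear_flow B) z0)) \<and>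
         (\<forall>x0. \<exists>k::nat. top_of_set (omega_limit \<phi> x0) homeomorphic_space torus k)"
proof -
  interpret strictly_nonexpansive_flow f \<phi> N
    by unfold_locales (rule assms)+
  obtain \<sigma> e where e: "limit_retraction \<sigma> e"
    using limit_retraction_exists by blast
  interpret retracted_flow f \<phi> N \<sigma> e
    by unfold_locales (rule e)
  obtain B xs where B: "conserved B"
    and conj: "\<And>x t. e x = x \<Longrightarrow> 0 \<le> t \<Longrightarrow> \<phi> t x = xs + linear_flow B t (x - xs)"
    by (rule conserved_linear_conjugate) blast
  have omega: "omega_limit \<phi> x0 = (\<lambda>z. xs + z) ` omega_limit (linear_flow B) (e x0 - xs)" for x0
  proof (rule omega_limit_asymptotic)
    have "\<forall>\<^sub>F t in at_top. \<phi> t x0 - \<phi> t (e x0) = \<phi> t x0 - (xs + linear_flow B t (e x0 - xs))"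
      using eventually_ge_at_top[of "0 :: real"] by eventually_elim (simp add: conj[OF retraction_idem])
    with retraction_attracts show "((\<lambda>t. \<phi> t x0 - (xs + linear_flow B t (e x0 - xs))) \<longlongrightarrow> 0) at_top"
      by (rule Lim_transform_eventually)
  qed
  have torus: "\<exists>k. top_of_set (omega_limit \<phi> x0) homeomorphic_space torus k" for x0
  proof -
    obtain k where k: "top_of_set (omega_limit (linear_flow B) (e x0 - xs)) homeomorphic_space torus k"
      using conserved_omega_limit_torus[OF B] by blast
    have "homeomorphic_maps (top_of_set (omega_limit \<phi> x0))
        (top_of_set (omega_limit (linear_flow B) (e x0 - xs))) (\<lambda>y. y - xs) (\<lambda>z. xs + z)"
      unfolding omega homeomorphic_maps_def continuous_map_subtopology_eu
      by (auto intro!: continuous_intros)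
    then have "top_of_set (omega_limit \<phi> x0) homeomorphic_space
        top_of_set (omega_limit (linear_flow B) (e x0 - xs))"
      unfolding homeomorphic_space_def by blast
    then show ?thesis
      using k homeomorphic_space_trans by blast
  qed
  show ?thesis
    using trajectory_bounded B omega torus by blast
qed

end
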